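(* Let $\{T_0,T_1,T_2,\dots\}$ be a countable set of Silver trees and let $f:2^\omega\times\omega^\omega\to 2^\omega$ be a Borel map. Then there is a set $\mathbb{U}'=\{S_0,S_1,S_2,\dots\}$ of Silver trees such that $S_n\subseteq T_n$ for all $n$ and $f$ is normalized on $S_0$ for $\mathbb{U}'$.
   Context: A tree $T\subseteq 2^{<\omega}$ is a Silver tree if there is an infinite sequence of finite binary tuples $u_k$ ($k<\omega$) such that $T$ consists exactly of all tuples $u_0{}^\frown i_0{}^\frown u_1{}^\frown i_1{}^\frown\cdots{}^\frown u_n{}^\frown i_n$ ($n<\omega$, $i_k\in\{0,1\}$) and their initial segments; $[T]\subseteq 2^\omega$ is its set of infinite branches. For $\sigma\in 2^{<\omega}$ and $a\in 2^\omega$, the shift $\sigma\cdot a\in 2^\omega$ is defined by $(\sigma\cdot a)(i)=a(i)+\sigma(i)\pmod 2$ for $i<\mathrm{lh}(\sigma)$ and $(\sigma\cdot a)(i)=a(i)$ for $i\ge\mathrm{lh}(\sigma)$; for $X\subseteq 2^\omega$, $\sigma\cdot X=\{\sigma\cdot a:a\in X\}$. For $v\in\omega^{<\omega}$, $N_v=\{x\in\omega^\omega: v\subset x\}$. A map $f:2^\omega\times\omega^\omega\to 2^\omega$ is normalized on a Silver tree $T$ for a set $\mathbb{U}$ of Silver trees if there is a dense $G_\delta$ set $X\subseteq\omega^\omega$ such that $f$ is continuous on $[T]\times X$ and either (1) there are $v\in\omega^{<\omega}$ and $\sigma\in 2^{<\omega}$ with $f(a,x)=\sigma\cdot a$ for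 all $a\in[T]$ and $x\in N_v\cap X$; or (2) $f(a,x)\notin\bigcup_{\sigma\in 2^{<\omega},\,S\in\mathbb{U}}\sigma\cdot[S]$ for all $a\in[T]$ and $x\in X$. *)

theory Defs
  imports "HOL-Analysis.Analysis" "HOL-Library.Sublist"
begin

text \<open>
  Binary digits are booleans (\<^term>\<open>False\<close> is 0, \<^term>\<open>True\<close> is 1), so
  \<^typ>\<open>nat \<Rightarrow> bool\<close> is Cantor space and \<^typ>\<open>nat \<Rightarrow> nat\<close> is Baire space, both with
  the library's product topology of discrete spaces.
\<close>

type_synonym cantor = "nat \<Rightarrow> bool"
type_synonym baire = "nat \<Rightarrow> nat"

definition silver_tuple :: "(nat \<Rightarrow> bool list) \<Rightarrow> (nat \<Rightarrow> bool) \<Rightarrow> nat \<Rightarrow> bool list" where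
  "silver_tuple u i n = concat (map (\<lambda>k. u k @ [i k]) [0..<Suc n])"

definition silver_tree :: "bool list set \<Rightarrow> bool" where
  "silver_tree T \<longleftrightarrow>
     (\<exists>u :: nat \<Rightarrow> bool list. T = {s. \<exists>n i. prefix s (silver_tuple u i n)})"

definition branches :: "bool list set \<Rightarrow> cantor set" where
  "branches T = {a. \<forall>n. map a [0..<n] \<in> T}"

text \<open>Addition modulo 2 of binary digits is inequality of booleans.\<close>

definition shift :: "bool list \<Rightarrow> cantor \<Rightarrow> cantor" where
  "shift \<sigma> a = (\<lambda>i. if i < length \<sigma> then a i \<noteq> \<sigma> ! i else a i)"

definition baire_nbhd :: "nat list \<Rightarrow> baire set" where
  "baire_nbhd v = {x. map x [0..<length v] = v}"

definition normalized_on ::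
  "(cantor \<times> baire \<Rightarrow> cantor) \<Rightarrow> bool list set \<Rightarrow> bool list set set \<Rightarrow> bool" where
  "normalized_on f T U \<longleftrightarrow>
     (\<exists>X :: baire set. gdelta X \<and> closure X = UNIV \<and>
        continuous_on (branches T \<times> X) f \<and>
        ((\<exists>v \<sigma>. \<forall>a \<in> branches T. \<forall>x \<in> baire_nbhd v \<inter> X. f (a, x) = shift \<sigma> a) \<or>
         (\<forall>a \<in> branches T. \<forall>x \<in> X. f (a, x) \<notin> (\<Union>\<sigma>. \<Union>S \<in> U. shift \<sigma> ` branches S))))"

end

theory Submission
  imports Defs
begin

text \<open>
  A Silver tree is the set of finite binary sequences that agree with a fixed \<open>b\<close> off an infinite
  set \<open>A\<close> of splitting levels.  By the Baire property relative to \<open>[T\<^sub>0] \<times> \<omega>\<^sup>\<omega>\<close>, \<open>f\<close> is continuous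
  on the intersection \<open>D\<close> of countably many relatively dense open sets.  Fusion thins out a Silver
  tree so that prescribed dense requirements on boxes are met, densely often in Baire space, for
  all branches at once; in particular one gets \<open>[S\<^sub>0] \<times> X \<subseteq> D\<close>.

  If on some box \<open>f (a, x)\<close> and \<open>a\<close> agree beyond some level \<open>L\<close>, then on a smaller box the first \<open>L\<close>
  digits of \<open>f (a, x)\<close> are constant, so \<open>f (a, x)\<close> is a shift of \<open>a\<close>.  Otherwise the fusion for
  \<open>S\<^sub>0\<close> can make \<open>f (a, x)\<close> differ from \<open>a\<close> at arbitrarily high non-splitting levels, which keeps it
  out of all shifts of \<open>[S\<^sub>0]\<close>.  The same fusion leaves so few values of \<open>f\<close> up to a given level that
  enough splitting levels of \<open>T\<^sub>n\<close> can be sacrificed to avoid them all.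
\<close>

section \<open>Cylinders and dense sets in Baire space\<close>

text \<open>A neighbourhood is named by a centre and a length, not by a finite sequence: this fits
  both spaces, and shrinking only means moving the centre and raising the length.\<close>

definition cyl :: "(nat \<Rightarrow> 'a) \<Rightarrow> nat \<Rightarrow> (nat \<Rightarrow> 'a) set" where
  "cyl a n = {c. \<forall>i<n. c i = a i}"

lemma cyl_self [simp]: "a \<in> cyl a n"
  by (simp add: cyl_def)

lemma cyl_mono: "c \<in> cyl a n \<Longrightarrow> n \<le> m \<Longrightarrow> cyl c m \<subseteq> cyl a n"
  by (auto simp: cyl_def)

lemma open_cyl: "open (cyl (a :: nat \<Rightarrow> 'a::discrete_topology) n)"
proof -
  have "cyl a n = (\<Inter>i\<in>{..<n}. (\<lambda>c. c i) -` {a i})"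
    by (auto simp: cyl_def)
  moreover have "open ((\<lambda>c :: nat \<Rightarrow> 'a. c i) -` {a i})" for i
    by (intro open_vimage continuous_on_product_coordinates open_discrete)
  ultimately show ?thesis
    by (auto intro!: open_INT)
qed

lemma open_contains_cyl:
  fixes U :: "(nat \<Rightarrow> 'a::discrete_topology) set"
  assumes "open U" "a \<in> U"
  shows "\<exists>n. cyl a n \<subseteq> U"
proof -
  have "openin (product_topology (\<lambda>i. euclidean) UNIV) U"
    using assms(1) by (simp add: open_fun_def)
  from product_topology_open_contains_basis[OF this assms(2)]
  obtain X where X: "a \<in> (\<Pi>\<^sub>E i\<in>UNIV. X i)" "finite {i. X i \<noteq> UNIV}" "(\<Pi>\<^sub>E i\<in>UNIV. X i) \<subseteq> U"
    by auto
  obtain n where n: "\<And>i. X i \<noteq> UNIV \<Longrightarrow> i < n"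
    using X(2) unfolding finite_nat_set_iff_bounded by auto
  have "cyl a n \<subseteq> (\<Pi>\<^sub>E i\<in>UNIV. X i)"
  proof
    fix c assume c: "c \<in> cyl a n"
    have "c i \<in> X i" for i
      using n[of i] c X(1) by (cases "X i = UNIV") (auto simp: cyl_def)
    then show "c \<in> (\<Pi>\<^sub>E i\<in>UNIV. X i)" by auto
  qed
  with X(3) show ?thesis by blast
qed

text \<open>The maximum of three lengths lets a single number measure a box in both factors;
  \<open>m\<close> makes it as large as wanted.\<close>

lemma open_contains_box:
  fixes U :: "((nat \<Rightarrow> 'a::discrete_topology) \<times> (nat \<Rightarrow> 'b::discrete_topology)) set"
  assumes "open U" "(a, x) \<in> U"
  shows "\<exists>n\<ge>m. cyl a n \<times> cyl x n \<subseteq> U"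
proof -
  obtain V W where VW: "open V" "open W" "(a, x) \<in> V \<times> W" "V \<times> W \<subseteq> U"
    using open_prod_elim[OF assms] by metis
  obtain k l where "cyl a k \<subseteq> V" "cyl x l \<subseteq> W"
    using VW open_contains_cyl by (metis mem_Times_iff fst_conv snd_conv)
  moreover have "cyl a (max m (max k l)) \<subseteq> cyl a k" "cyl x (max m (max k l)) \<subseteq> cyl x l"
    by (auto simp: cyl_def)
  ultimately show ?thesis
    using VW(4) by (intro exI[of _ "max m (max k l)"]) (simp, blast)
qed

text \<open>A direct Baire category argument: for each \<open>i\<close> the cylinders satisfying
  \<open>Q i\<close> have an open union, and nested cylinders chosen inside a given open set,
  serving one index after another, shrink to a point of \<open>X\<close>.\<close>

lemma dense_gdelta_of_cyls:
  fixes Q :: "'i::countable \<Rightarrow> baire \<Rightarrow> nat \<Rightarrow> bool"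
  assumes "\<And>i x n. \<exists>x'\<in>cyl x n. \<exists>n'\<ge>n. Q i x' n'"
  defines "X \<equiv> {y. \<forall>i. \<exists>x n. y \<in> cyl x n \<and> Q i x n}"
  shows "gdelta X" "closure X = UNIV"
proof -
  define U where "U k = \<Union>{cyl x n |x n. Q (from_nat k :: 'i) x n}" for k
  have "X = (\<Inter>k. U k)"
  proof (intro equalityI subsetI)
    fix y assume y: "y \<in> (\<Inter>k. U k)"
    have "\<exists>x n. y \<in> cyl x n \<and> Q i x n" for i
      using INT_D[OF y UNIV_I, of "to_nat i"] by (auto simp: U_def)
    then show "y \<in> X" by (simp add: X_def)
  qed (fastforce simp: X_def U_def)
  moreover have "open (U k)" for k
    unfolding U_def by (auto intro: open_cyl)
  ultimately show "gdelta X"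
    using gdelta.intros by metis
  show "closure X = UNIV"
  proof (intro set_eqI iffI UNIV_I)
    fix z
    have "\<exists>y\<in>X. y \<in> O'" if O': "open O'" "z \<in> O'" for O'
    proof -
      obtain n0 where n0: "cyl z n0 \<subseteq> O'"
        using open_contains_cyl O' by blast
      \<comment> \<open>A state is a pair of centre and length. The stored length is one more than
        the length at which \<open>Q\<close> was met, so that lengths grow strictly; hence the
        \<open>- 1\<close>.\<close>
      have "\<exists>s. \<forall>k. cyl (fst (s k)) (snd (s k)) \<subseteq> O' \<and> k \<le> snd (s k) \<and>
          (fst (s (Suc k)) \<in> cyl (fst (s k)) (snd (s k)) \<and> snd (s k) < snd (s (Suc k)) \<and>
           Q (from_nat k) (fst (s (Suc k))) (snd (s (Suc k)) - 1))"
      proof -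
        have step: "\<exists>t. (cyl (fst t) (snd t) \<subseteq> O' \<and> Suc k \<le> snd t) \<and>
            (fst t \<in> cyl (fst s) (snd s) \<and> snd s < snd t \<and> Q (from_nat k) (fst t) (snd t - 1))"
          if s: "cyl (fst s) (snd s) \<subseteq> O' \<and> k \<le> snd s" for s k
        proof -
          obtain x' n' where x': "x' \<in> cyl (fst s) (snd s)" "n' \<ge> snd s" "Q (from_nat k) x' n'"
            using assms(1) by blast
          have "cyl x' (Suc n') \<subseteq> O'"
            using s x' cyl_mono[of x' "fst s" "snd s" "Suc n'"] by auto
          then show ?thesis
            using s x' by (intro exI[of _ "(x', Suc n')"]) auto
        qed
        have "\<exists>s. cyl (fst s) (snd s) \<subseteq> O' \<and> 0 \<le> snd s"
          using n0 by (intro exI[of _ "(z, n0)"]) auto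
        from dependent_nat_choice[of "\<lambda>k s. cyl (fst s) (snd s) \<subseteq> O' \<and> k \<le> snd s"
            "\<lambda>k s t. fst t \<in> cyl (fst s) (snd s) \<and> snd s < snd t \<and> Q (from_nat k) (fst t) (snd t - 1)",
            OF this step]
        show ?thesis by (simp add: conj_assoc)
      qed
      then obtain s where s: "\<And>k. cyl (fst (s k)) (snd (s k)) \<subseteq> O' \<and> k \<le> snd (s k) \<and>
          (fst (s (Suc k)) \<in> cyl (fst (s k)) (snd (s k)) \<and> snd (s k) < snd (s (Suc k)) \<and>
           Q (from_nat k) (fst (s (Suc k))) (snd (s (Suc k)) - 1))"
        by blast
      define x n where "x k = fst (s k)" and "n k = snd (s k)" for k
      have xn: "\<And>k. cyl (x k) (n k) \<subseteq> O'" "\<And>k. k \<le> n k"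
          "\<And>k. x (Suc k) \<in> cyl (x k) (n k)" "\<And>k. n k < n (Suc k)"
          "\<And>k. Q (from_nat k) (x (Suc k)) (n (Suc k) - 1)"
        using s by (simp_all add: x_def n_def)
      have sub: "x (k + d) \<in> cyl (x k) (n k)" for k d
      proof (induction d)
        case (Suc d)
        have "n k \<le> n (k + d)"
          using xn(4) by (simp add: lift_Suc_mono_le less_imp_le)
        then show ?case
          using xn(3)[of "k + d"] Suc by (auto simp: cyl_def)
      qed simp
      \<comment> \<open>Digit \<open>i\<close> is frozen from stage \<open>Suc i\<close> on, because
        \<open>n (Suc i)\<close> exceeds \<open>i\<close>; so \<open>y\<close> lies in all the
        cylinders.\<close>
      define y where "y i = x (Suc i) i" for i
      have y: "y \<in> cyl (x k) (n k)" for k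
        unfolding cyl_def
      proof safe
        fix i assume "i < n k"
        moreover have "i < n (Suc i)" using xn(2)[of "Suc i"] by simp
        ultimately show "y i = x k i"
          using sub[of "Suc i" "k - Suc i"] sub[of k "Suc i - k"]
          by (cases "Suc i \<le> k") (auto simp: y_def cyl_def)
      qed
      have "\<exists>x n. y \<in> cyl x n \<and> Q i x n" for i
        using y[of "Suc (to_nat i)"] xn(5)[of "to_nat i"]
        by (intro exI[of _ "x (Suc (to_nat i))"] exI[of _ "n (Suc (to_nat i)) - 1"])
           (auto simp: cyl_def)
      then have "y \<in> X" by (simp add: X_def)
      moreover have "y \<in> O'" using y xn(1) by blast
      ultimately show ?thesis by blast
    qed
    then show "z \<in> closure X"
      unfolding closure_def islimpt_def by blast
  qed
qed

section \<open>The Baire property relative to a subspace\<close>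

text \<open>The roles of \<open>V\<close> and \<open>W\<close> are symmetric, which makes complementation trivial.\<close>

lemma borel_relative_baire_property:
  fixes B :: "'a::topological_space set"
  assumes "B \<in> sets borel"
  shows "\<exists>V W \<G>. open V \<and> open W \<and> countable \<G> \<and>
     (\<forall>G\<in>\<G>. open G \<and> (\<forall>U. open U \<longrightarrow> U \<inter> Y \<noteq> {} \<longrightarrow> U \<inter> Y \<inter> G \<noteq> {})) \<and>
     (\<exists>G\<in>\<G>. G \<subseteq> V \<union> W) \<and> (\<forall>z\<in>Y \<inter> \<Inter>\<G>. (z \<in> V \<longrightarrow> z \<in> B) \<and> (z \<in> W \<longrightarrow> z \<notin> B))"
    (is "?P B")
proof -
  let ?d = "\<lambda>G. open G \<and> (\<forall>U. open U \<longrightarrow> U \<inter> Y \<noteq> {} \<longrightarrow> U \<inter> Y \<inter> G \<noteq> {})"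
  \<comment> \<open>An open set that misses \<open>V \<inter> Y\<close> also misses its closure, so
    \<open>V\<close> and the exterior of its trace on \<open>Y\<close> together are dense relative
    to \<open>Y\<close>.\<close>
  have d: "?d (V \<union> - closure (V \<inter> Y))" if "open V" for V
  proof (intro conjI allI impI)
    fix U assume U: "open U" "U \<inter> Y \<noteq> {}"
    show "U \<inter> Y \<inter> (V \<union> - closure (V \<inter> Y)) \<noteq> {}"
    proof (cases "U \<inter> (V \<inter> Y) = {}")
      case True
      then have "U \<inter> closure (V \<inter> Y) = {}"
        using U(1) open_Int_closure_eq_empty by blast
      then show ?thesis using U by blast
    qed blast
  qed (use that in auto)
  have cl: "z \<in> Y \<Longrightarrow> z \<in> - closure (V \<inter> Y) \<Longrightarrow> z \<notin> V" for z V
    using closure_subset[of "V \<inter> Y"] by auto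
  have "B \<in> sigma_sets UNIV {S. open S}"
    using assms by (simp add: borel_def)
  then show ?thesis
  proof induction
    case (Basic B)
    then have o: "open B" by simp
    show ?case
      by (rule exI[of _ B], rule exI[of _ "- closure (B \<inter> Y)"],
          rule exI[of _ "{B \<union> - closure (B \<inter> Y)}"])
         (use o d[OF o] cl[of _ B] in auto)
  next
    case Empty
    show ?case
      by (rule exI[of _ "{}"], rule exI[of _ UNIV], rule exI[of _ "{UNIV}"]) auto
  next
    case (Compl B)
    then obtain V W \<G> where "open V" "open W" "countable \<G>" "\<forall>G\<in>\<G>. ?d G"
      "\<exists>G\<in>\<G>. G \<subseteq> V \<union> W" "\<forall>z\<in>Y \<inter> \<Inter>\<G>. (z \<in> V \<longrightarrow> z \<in> B) \<and> (z \<in> W \<longrightarrow> z \<notin> B)"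
      by auto
    then show ?case
      by (intro exI[of _ W] exI[of _ V] exI[of _ \<G>]) (auto simp: Un_commute)
  next
    case (Union B)
    have "\<forall>i. \<exists>V W \<G>. open V \<and> open W \<and> countable \<G> \<and> (\<forall>G\<in>\<G>. ?d G) \<and>
       (\<exists>G\<in>\<G>. G \<subseteq> V \<union> W) \<and> (\<forall>z\<in>Y \<inter> \<Inter>\<G>. (z \<in> V \<longrightarrow> z \<in> B i) \<and> (z \<in> W \<longrightarrow> z \<notin> B i))"
      using Union(2) by blast
    then obtain V W \<G> where VW: "\<And>i. open (V i)" "\<And>i. countable (\<G> i)"
        "\<And>i. \<forall>G\<in>\<G> i. ?d G" "\<And>i. \<exists>G\<in>\<G> i. G \<subseteq> V i \<union> W i"
        "\<And>i. \<forall>z\<in>Y \<inter> \<Inter>(\<G> i). (z \<in> V i \<longrightarrow> z \<in> B i) \<and> (z \<in> W i \<longrightarrow> z \<notin> B i)"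
      by metis
    define V' where "V' = (\<Union>i. V i)"
    have o: "open V'" using VW(1) by (auto simp: V'_def)
    \<comment> \<open>An intersection of the sets \<open>W i\<close> need not be open, so the
      negative side becomes the exterior of \<open>V' \<inter> Y\<close>, at the cost of one more
      dense open set. For generic points, lying outside \<open>V'\<close> forces membership in every
      \<open>W i\<close>.\<close>
    define \<G>' where "\<G>' = insert (V' \<union> - closure (V' \<inter> Y)) (\<Union>i. \<G> i)"
    have "\<forall>z\<in>Y \<inter> \<Inter>\<G>'. (z \<in> V' \<longrightarrow> z \<in> (\<Union>i. B i)) \<and>
        (z \<in> - closure (V' \<inter> Y) \<longrightarrow> z \<notin> (\<Union>i. B i))"
    proof (intro ballI conjI impI)
      fix z assume z: "z \<in> Y \<inter> \<Inter>\<G>'"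
      then have zi: "z \<in> Y \<inter> \<Inter>(\<G> i)" for i by (auto simp: \<G>'_def)
      show "z \<in> (\<Union>i. B i)" if zV: "z \<in> V'"
      proof -
        obtain i where "z \<in> V i" using zV by (auto simp: V'_def)
        then show ?thesis using VW(5)[of i] zi[of i] by blast
      qed
      show "z \<notin> (\<Union>i. B i)" if "z \<in> - closure (V' \<inter> Y)"
      proof -
        have "z \<notin> V'" using cl z that by blast
        then have "z \<in> W i" for i
          using VW(4)[of i] zi[of i] by (auto simp: V'_def)
        then have "z \<notin> B i" for i using VW(5)[of i] zi[of i] by blast
        then show ?thesis by blast
      qed
    qed
    moreover have "\<forall>G\<in>\<G>'. ?d G" "countable \<G>'" "\<exists>G\<in>\<G>'. G \<subseteq> V' \<union> - closure (V' \<inter> Y)"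
      using d[OF o] VW(2,3) by (auto simp: \<G>'_def)
    ultimately show ?case
      using o by (intro exI[of _ V'] exI[of _ "- closure (V' \<inter> Y)"] exI[of _ \<G>']) auto
  qed
qed

section \<open>Silver trees as cubes\<close>

definition cube :: "nat set \<Rightarrow> cantor \<Rightarrow> cantor set" where
  "cube A b = {a. \<forall>i. i \<notin> A \<longrightarrow> a i = b i}"

definition cube_tree :: "nat set \<Rightarrow> cantor \<Rightarrow> bool list set" where
  "cube_tree A b = {s. \<forall>i<length s. i \<notin> A \<longrightarrow> s ! i = b i}"

lemma cube_subset: "A' \<subseteq> A \<Longrightarrow> b' \<in> cube A b \<Longrightarrow> cube A' b' \<subseteq> cube A b"
  by (auto simp: cube_def)

lemma cube_tree_subset: "A' \<subseteq> A \<Longrightarrow> b' \<in> cube A b \<Longrightarrow> cube_tree A' b' \<subseteq> cube_tree A b"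
  by (auto simp: cube_def cube_tree_def)

lemma branches_cube_tree: "branches (cube_tree A b) = cube A b"
proof (intro equalityI subsetI)
  fix a assume a: "a \<in> branches (cube_tree A b)"
  have "a i = b i" if "i \<notin> A" for i
  proof -
    have "map a [0..<Suc i] \<in> cube_tree A b"
      using a unfolding branches_def by blast
    then have "map a [0..<Suc i] ! i = b i"
      using that unfolding cube_tree_def by simp
    then show ?thesis by (simp del: upt_Suc)
  qed
  then show "a \<in> cube A b" by (simp add: cube_def)
qed (auto simp: branches_def cube_def cube_tree_def)

text \<open>The level of the digit \<open>i n\<close> in a tuple: the blocks \<open>u 0\<close> to
  \<open>u n\<close> and \<open>n\<close> earlier free digits come before it.\<close>

definition split_pos :: "(nat \<Rightarrow> bool list) \<Rightarrow> nat \<Rightarrow> nat" where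
  "split_pos u n = length (concat (map u [0..<Suc n])) + n"

lemma silver_tuple_Suc:
  "silver_tuple u i (Suc n) = silver_tuple u i n @ u (Suc n) @ [i (Suc n)]"
  by (simp add: silver_tuple_def)

lemma length_silver_tuple: "length (silver_tuple u i n) = Suc (split_pos u n)"
  by (induction n) (simp_all add: silver_tuple_Suc split_pos_def silver_tuple_def)

lemma split_pos_less: "split_pos u n < split_pos u (Suc n)"
  by (simp add: split_pos_def)

lemma le_split_pos: "n \<le> split_pos u n"
  by (simp add: split_pos_def)

lemma split_pos_mono: "k \<le> n \<Longrightarrow> split_pos u k \<le> split_pos u n"
  by (rule lift_Suc_mono_le) (simp_all add: split_pos_less less_imp_le)

lemma silver_tuple_nth_le:
  assumes "k \<le> n" "j \<le> split_pos u k"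
  shows "silver_tuple u i n ! j = silver_tuple u i k ! j"
  using assms(1)
proof (induction n rule: dec_induct)
  case (step n)
  then have "j < length (silver_tuple u i n)"
    using assms(2) split_pos_mono[of k n u] by (simp add: length_silver_tuple)
  then show ?case using step by (simp add: silver_tuple_Suc nth_append)
qed simp

lemma silver_tuple_nth_split_pos:
  assumes "k \<le> n"
  shows "silver_tuple u i n ! split_pos u k = i k"
proof -
  have "last (silver_tuple u i k) = i k"
    by (simp add: silver_tuple_def)
  moreover have "silver_tuple u i k \<noteq> []"
    using length_silver_tuple[of u i k] by auto
  ultimately have "silver_tuple u i k ! split_pos u k = i k"
    using length_silver_tuple[of u i k] by (simp add: last_conv_nth)
  then show ?thesis using silver_tuple_nth_le[OF assms] by simp
qed

text \<open>A digit off the splitting levels lies inside one of the blocks \<open>u k\<close>, which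
  do not involve \<open>i\<close>.\<close>

lemma silver_tuple_nth_cong:
  assumes "j \<notin> range (split_pos u)" "j \<le> split_pos u n"
  shows "silver_tuple u i n ! j = silver_tuple u i' n ! j"
  using assms
proof (induction n)
  case 0
  have "j \<noteq> split_pos u 0" using 0 by blast
  then have "j < length (u 0)" using 0(2) by (simp add: split_pos_def)
  then show ?case by (simp add: silver_tuple_def nth_append)
next
  case (Suc n)
  show ?case
  proof (cases "j \<le> split_pos u n")
    case True
    then show ?thesis
      using Suc by (simp add: silver_tuple_Suc nth_append length_silver_tuple)
  next
    case False
    have "j \<noteq> split_pos u (Suc n)" using Suc.prems by blast
    then have "j - Suc (split_pos u n) < length (u (Suc n))"
      using Suc.prems False by (simp add: split_pos_def)
    then show ?thesis
      using False by (simp add: silver_tuple_Suc nth_append length_silver_tuple)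
  qed
qed

text \<open>Both translations between Silver trees and cubes go through this equality. The premise
  samples tuple number \<open>j\<close> at digit \<open>j\<close>, which is long enough by
  \<open>le_split_pos\<close>; the free digits there are arbitrarily set to 0.\<close>

lemma silver_tree_eq_cube_tree:
  assumes "\<And>j. j \<notin> range (split_pos u) \<Longrightarrow> silver_tuple u (\<lambda>_. False) j ! j = b j"
  shows "{s. \<exists>n i. prefix s (silver_tuple u i n)} = cube_tree (range (split_pos u)) b"
proof (intro equalityI subsetI)
  fix s assume "s \<in> {s. \<exists>n i. prefix s (silver_tuple u i n)}"
  then obtain n i where s: "prefix s (silver_tuple u i n)" by auto
  have "s ! j = b j" if j: "j < length s" "j \<notin> range (split_pos u)" for j
  proof -
    have jn: "j \<le> split_pos u n"
      using prefix_length_le[OF s] j(1) by (simp add: length_silver_tuple)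
    have "s ! j = silver_tuple u i n ! j"
      using s j(1) by (auto simp: prefix_def nth_append)
    also have "\<dots> = silver_tuple u (\<lambda>_. False) n ! j"
      using silver_tuple_nth_cong j(2) jn by blast
    also have "\<dots> = silver_tuple u (\<lambda>_. False) (max n j) ! j"
      using silver_tuple_nth_le[of n "max n j"] jn by simp
    also have "\<dots> = silver_tuple u (\<lambda>_. False) j ! j"
      using silver_tuple_nth_le[of j "max n j" j] le_split_pos by simp
    finally show ?thesis using assms j(2) by simp
  qed
  then show "s \<in> cube_tree (range (split_pos u)) b" by (simp add: cube_tree_def)
next
  fix s assume s: "s \<in> cube_tree (range (split_pos u)) b"
  \<comment> \<open>The free digits are read off \<open>s\<close> at the splitting levels;
    \<open>length s\<close> as last index gives a tuple longer than \<open>s\<close>.\<close>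
  let ?t = "silver_tuple u (\<lambda>k. s ! split_pos u k) (length s)"
  have len: "length s < length ?t"
    using le_split_pos[of "length s" u] by (simp add: length_silver_tuple)
  have "s ! j = ?t ! j" if j: "j < length s" for j
  proof (cases "j \<in> range (split_pos u)")
    case True
    then obtain k where k: "j = split_pos u k" by blast
    then have "k \<le> length s" using le_split_pos[of k u] j by simp
    then show ?thesis using k by (simp add: silver_tuple_nth_split_pos)
  next
    case False
    have "?t ! j = silver_tuple u (\<lambda>k. s ! split_pos u k) j ! j"
      using j le_split_pos by (simp add: silver_tuple_nth_le)
    also have "\<dots> = silver_tuple u (\<lambda>_. False) j ! j"
      using silver_tuple_nth_cong[OF False le_split_pos] .
    also have "\<dots> = b j" using assms False .
    finally show ?thesis using s j False by (simp add: cube_tree_def)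
  qed
  then have "s = take (length s) ?t"
    using len by (intro nth_equalityI) auto
  then show "s \<in> {s. \<exists>n i. prefix s (silver_tuple u i n)}"
    using take_is_prefix[of "length s" ?t] by auto
qed

lemma silver_treeE:
  assumes "silver_tree T"
  obtains A b where "infinite A" "T = cube_tree A b"
proof -
  obtain u where u: "T = {s. \<exists>n i. prefix s (silver_tuple u i n)}"
    using assms by (auto simp: silver_tree_def)
  have "inj (split_pos u)"
    by (rule strict_mono_imp_inj_on) (simp add: strict_mono_Suc_iff split_pos_less)
  then have "infinite (range (split_pos u))"
    using finite_imageD by blast
  then show ?thesis using that silver_tree_eq_cube_tree[OF refl] u by blast
qed

lemma silver_tree_cube_tree:
  assumes "infinite A"
  shows "silver_tree (cube_tree A b)"
proof -
  define e where "e = enumerate A"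
  \<comment> \<open>The blocks are the pieces of \<open>b\<close> before the least element of
    \<open>A\<close> and strictly between consecutive elements, so that the splitting levels become
    the enumeration \<open>e\<close>.\<close>
  define u where "u k = map b [(case k of 0 \<Rightarrow> 0 | Suc l \<Rightarrow> Suc (e l))..<e k]" for k
  have u_Suc: "u (Suc n) = map b [Suc (e n)..<e (Suc n)]" for n
    by (simp add: u_def)
  have e: "e k < e (Suc k)" for k
    using assms by (simp add: e_def enumerate_step)
  have "split_pos u n = e n" for n
  proof (induction n)
    case 0
    show ?case by (simp add: split_pos_def u_def)
  next
    case (Suc n)
    have "split_pos u (Suc n) = split_pos u n + length (u (Suc n)) + 1"
      by (simp add: split_pos_def)
    also have "length (u (Suc n)) = e (Suc n) - Suc (e n)"
      by (simp add: u_Suc)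
    also have "split_pos u n + (e (Suc n) - Suc (e n)) + 1 = e (Suc n)"
      using Suc e[of n] by simp
    finally show ?case .
  qed
  then have sp: "split_pos u = e" by blast
  have "silver_tuple u (\<lambda>_. False) n ! j = b j" if "j \<notin> A" "j \<le> e n" for n j
    using that
  proof (induction n)
    case 0
    have "e 0 \<in> A" using assms by (simp add: e_def enumerate_in_set)
    then have "j < e 0" using 0 by (metis nat_less_le)
    then show ?case by (simp add: silver_tuple_def u_def nth_append)
  next
    case (Suc n)
    show ?case
    proof (cases "j \<le> e n")
      case True
      then show ?thesis
        using Suc by (simp add: silver_tuple_Suc nth_append length_silver_tuple sp)
    next
      case False
      have "e (Suc n) \<in> A" using assms by (simp add: e_def enumerate_in_set)
      then have "j < e (Suc n)" using Suc.prems by (metis nat_less_le)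
      then have "j - Suc (e n) < e (Suc n) - Suc (e n)" using False by simp
      then show ?thesis
        using False by (simp add: silver_tuple_Suc nth_append length_silver_tuple sp u_Suc)
    qed
  qed
  moreover have "range e = A"
    using assms by (simp add: e_def range_enumerate)
  ultimately have "{s. \<exists>n i. prefix s (silver_tuple u i n)} = cube_tree A b"
    using silver_tree_eq_cube_tree[of u b] sp le_split_pos[of _ u] by simp
  then show ?thesis unfolding silver_tree_def by blast
qed

section \<open>Fusion\<close>

text \<open>\<open>R a x n\<close> is thought of as a requirement on the box
  \<open>cyl a n \<times> cyl x n\<close>. Inheritance by smaller boxes is what lets many
  requirements be met one after another.\<close>

definition persistent :: "(cantor \<Rightarrow> baire \<Rightarrow> nat \<Rightarrow> bool) \<Rightarrow> bool" where
  "persistent R \<longleftrightarrow> (\<forall>a x n a' x' n'.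
     R a x n \<longrightarrow> n \<le> n' \<longrightarrow> a' \<in> cyl a n \<longrightarrow> x' \<in> cyl x n \<longrightarrow> R a' x' n')"

definition dense_on :: "cantor set \<Rightarrow> (cantor \<Rightarrow> baire \<Rightarrow> nat \<Rightarrow> bool) \<Rightarrow> bool" where
  "dense_on C R \<longleftrightarrow> (\<forall>a\<in>C. \<forall>x n. \<exists>a'\<in>C \<inter> cyl a n. \<exists>x'\<in>cyl x n. \<exists>n'\<ge>n. R a' x' n')"

lemma persistentD:
  "persistent R \<Longrightarrow> R a x n \<Longrightarrow> n \<le> n' \<Longrightarrow> a' \<in> cyl a n \<Longrightarrow> x' \<in> cyl x n \<Longrightarrow> R a' x' n'"
  unfolding persistent_def by blast

lemma dense_onE:
  assumes "dense_on C R" "a \<in> C"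
  obtains a' x' n' where "a' \<in> C" "a' \<in> cyl a n" "x' \<in> cyl x n" "n \<le> n'" "R a' x' n'"
  using assms unfolding dense_on_def by blast

lemma persistent_conj:
  "persistent R \<Longrightarrow> persistent R' \<Longrightarrow> persistent (\<lambda>a x n. R a x n \<and> R' a x n)"
  unfolding persistent_def by blast

lemma persistent_all_less:
  "(\<And>i. persistent (R i)) \<Longrightarrow> persistent (\<lambda>a x n. \<forall>i<k::nat. R i a x n)"
  unfolding persistent_def by blast

text \<open>Meet \<open>R\<close> first and then \<open>R'\<close> in a smaller box, where
  \<open>R\<close> survives.\<close>

lemma dense_on_conj:
  assumes "persistent R" "dense_on C R" "dense_on C R'"
  shows "dense_on C (\<lambda>a x n. R a x n \<and> R' a x n)"
  unfolding dense_on_def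
proof (intro ballI allI)
  fix a x n assume "a \<in> C"
  then obtain a1 x1 n1 where 1: "a1 \<in> C" "a1 \<in> cyl a n" "x1 \<in> cyl x n" "n \<le> n1" "R a1 x1 n1"
    by (rule dense_onE[OF assms(2)])
  obtain a2 x2 n2 where 2: "a2 \<in> C" "a2 \<in> cyl a1 n1" "x2 \<in> cyl x1 n1" "n1 \<le> n2" "R' a2 x2 n2"
    by (rule dense_onE[OF assms(3) 1(1)])
  have "R a2 x2 n2" using assms(1)[THEN persistentD, OF 1(5) 2(4,2,3)] .
  moreover have "a2 \<in> cyl a n" "x2 \<in> cyl x n" "n \<le> n2"
    using 1 2 by (auto simp: cyl_def)
  ultimately show "\<exists>a'\<in>C \<inter> cyl a n. \<exists>x'\<in>cyl x n. \<exists>n'\<ge>n. R a' x' n' \<and> R' a' x' n'"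
    using 2 by blast
qed

lemma dense_on_all_less:
  assumes "\<And>i. persistent (R i)" "\<And>i. dense_on C (R i)"
  shows "dense_on C (\<lambda>a x n. \<forall>i<k::nat. R i a x n)"
proof (induction k)
  case 0
  show ?case unfolding dense_on_def by (auto intro: cyl_self)
next
  case (Suc k)
  have "dense_on C (\<lambda>a x n. (\<forall>i<k. R i a x n) \<and> R k a x n)"
    by (intro dense_on_conj persistent_all_less Suc assms)
  moreover have "(\<lambda>a x n. \<forall>i<Suc k. R i a x n) = (\<lambda>a x n. (\<forall>i<k. R i a x n) \<and> R k a x n)"
    by (auto simp: less_Suc_eq fun_eq_iff)
  ultimately show ?case by simp
qed

text \<open>The finitely many assignments on \<open>F\<close> are treated one at a time: each
  obtains an extension through density, the extension is kept off \<open>F\<close> for the others,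
  and persistence protects what has been achieved.\<close>

lemma fusion_step:
  assumes R: "persistent R" "dense_on (cube A b) R"
    and F: "finite F" "F \<subseteq> A" "F \<subseteq> {..<L}" and c: "c \<in> cube A b"
  shows "\<exists>c'\<in>cube A b \<inter> cyl c L. \<exists>x'\<in>cyl x n. \<exists>n'\<ge>n. L \<le> n' \<and>
    (\<forall>a. (\<forall>i<n'. i \<notin> F \<longrightarrow> a i = c' i) \<longrightarrow> R a x' n')"
proof -
  \<comment> \<open>An assignment on \<open>F\<close> is coded by the set of coordinates with digit
    1; \<open>\<G>\<close> collects those already treated.\<close>
  have "\<exists>c'\<in>cube A b \<inter> cyl c L. \<exists>x'\<in>cyl x n. \<exists>n'\<ge>n. L \<le> n' \<and>
    (\<forall>a. (\<exists>g\<in>\<G>. \<forall>i<n'. a i = (if i \<in> F then i \<in> g else c' i)) \<longrightarrow> R a x' n')"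
    if "finite \<G>" for \<G> :: "nat set set"
    using that
  proof induction
    case empty
    show ?case using c by (intro bexI[of _ c] bexI[of _ x] exI[of _ "max n L"]) auto
  next
    case (insert g \<G>)
    from insert.IH obtain c1 x1 n1 where 1: "c1 \<in> cube A b" "c1 \<in> cyl c L" "x1 \<in> cyl x n" "n \<le> n1" "L \<le> n1"
      "\<forall>a. (\<exists>g\<in>\<G>. \<forall>i<n1. a i = (if i \<in> F then i \<in> g else c1 i)) \<longrightarrow> R a x1 n1"
      by blast
    define a where "a i = (if i \<in> F then i \<in> g else c1 i)" for i
    have "a \<in> cube A b" using 1(1) F(2) by (auto simp: a_def cube_def)
    then obtain a2 x2 n2 where 2: "a2 \<in> cube A b" "a2 \<in> cyl a n1" "x2 \<in> cyl x1 n1" "n1 \<le> n2"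
      "R a2 x2 n2"
      by (rule dense_onE[OF R(2)])
    \<comment> \<open>Undoing the assignment \<open>g\<close> on \<open>F\<close> leaves
      \<open>c1\<close> below \<open>n1\<close> and \<open>a2\<close> off \<open>F\<close>, so the
      same centre serves all assignments.\<close>
    define c2 where "c2 i = (if i \<in> F then c1 i else a2 i)" for i
    have c12: "c2 i = c1 i" if "i < n1" for i
      using that 2(2) by (auto simp: c2_def a_def cyl_def)
    have c2: "c2 \<in> cube A b" "c2 \<in> cyl c L"
      using 1(1,2,5) 2(1) c12 by (auto simp: c2_def cube_def cyl_def)
    moreover have "x2 \<in> cyl x n" "n \<le> n2" "L \<le> n2"
      using 1(3-5) 2(3,4) by (auto simp: cyl_def)
    moreover have "R e x2 n2"
      if h: "h \<in> insert g \<G>" "\<forall>i<n2. e i = (if i \<in> F then i \<in> h else c2 i)" for e h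
    proof (cases "h = g")
      case True
      have "e i = a2 i" if "i < n2" for i
      proof (cases "i \<in> F")
        case iF: True
        then have "i < n1" using F(3) 1(5) by auto
        then have "a2 i = a i" using 2(2) by (simp add: cyl_def)
        then show ?thesis using h(2) that iF True by (simp add: a_def)
      next
        case False
        then show ?thesis using h(2) that by (simp add: c2_def)
      qed
      then have "e \<in> cyl a2 n2" by (simp add: cyl_def)
      then show ?thesis using R(1)[THEN persistentD, OF 2(5), of n2 e x2] by simp
    next
      case False
      then have "h \<in> \<G>" using h(1) by blast
      moreover have "\<forall>i<n1. e i = (if i \<in> F then i \<in> h else c1 i)"
        using h(2) c12 2(4) by simp
      ultimately have "R e x1 n1" using 1(6) by blast
      then show ?thesis using R(1)[THEN persistentD, OF _ 2(4) _ 2(3), of e e] by simp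
    qed
    then have "\<forall>e. (\<exists>h\<in>insert g \<G>. \<forall>i<n2. e i = (if i \<in> F then i \<in> h else c2 i)) \<longrightarrow> R e x2 n2"
      by blast
    ultimately show ?case by blast
  qed
  from this[of "Pow F"] F(1) obtain c' x' n' where *: "c' \<in> cube A b \<inter> cyl c L" "x' \<in> cyl x n"
    "n \<le> n'" "L \<le> n'"
    "\<forall>a. (\<exists>g\<in>Pow F. \<forall>i<n'. a i = (if i \<in> F then i \<in> g else c' i)) \<longrightarrow> R a x' n'"
    by blast
  have "R a x' n'" if "\<forall>i<n'. i \<notin> F \<longrightarrow> a i = c' i" for a
    using that by (intro *(5)[rule_format] bexI[of _ "{i\<in>F. a i}"]) auto
  then have "\<forall>a. (\<forall>i<n'. i \<notin> F \<longrightarrow> a i = c' i) \<longrightarrow> R a x' n'" by blast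
  then show ?thesis using *(1-4) by blast
qed

text \<open>
  Basic neighbourhoods of Baire space are enumerated so that each recurs infinitely often.  At
  stage \<open>m\<close> the finite set \<open>F\<close> of coordinates declared free so far lies below \<open>L\<close>, the values
  below \<open>L\<close> are frozen, and one common extension decides the requirement for all assignments
  on \<open>F\<close>.
\<close>

lemma fusion:
  assumes A: "infinite A"
    and R: "\<And>L. persistent (R L)" "\<And>L. dense_on (cube A b) (R L)"
  obtains A' b' where "infinite A'" "A' \<subseteq> A" "b' \<in> cube A b"
    "\<forall>x n k. \<exists>L\<ge>k. \<exists>x'\<in>cyl x n. \<exists>n'\<ge>n. L \<le> n' \<and> A' \<inter> {L..<n'} = {} \<and>
       (\<forall>a\<in>cube A' b'. R L a x' n')"
proof -
  define y :: "nat \<Rightarrow> baire" where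
    "y m i = (let v = from_nat (fst (prod_decode m)) in if i < length v then v ! i else 0)" for m i
  define N :: "nat \<Rightarrow> nat" where
    "N m = length (from_nat (fst (prod_decode m)) :: nat list)" for m
  have enum: "\<exists>m\<ge>k. N m = n \<and> y m \<in> cyl x n" for x n k
  proof -
    define m where "m = prod_encode (to_nat (map x [0..<n]), k)"
    have "N m = n" "y m \<in> cyl x n" "m \<ge> k"
      by (auto simp: N_def y_def m_def cyl_def le_prod_encode_2)
    then show ?thesis by blast
  qed
  define P where "P m s = (case s of (c, F, L) \<Rightarrow>
      c \<in> cube A b \<and> finite F \<and> F \<subseteq> A \<and> F \<subseteq> {..<L} \<and> m \<le> L)" for m :: nat and s
  \<comment> \<open>The new free coordinate is \<open>L' - 1\<close>, which is at least
    \<open>n'\<close>, so no level from \<open>L\<close> up to \<open>n'\<close> is freed at this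
    stage.\<close>
  define Q where "Q m s t = (case s of (c, F, L) \<Rightarrow> case t of (c', F', L') \<Rightarrow>
      c' \<in> cyl c L \<and> L < L' \<and> F' = insert (L' - 1) F \<and>
      (\<exists>x'\<in>cyl (y m) (N m). \<exists>n'\<ge>N m. L \<le> n' \<and> n' < L' \<and>
        (\<forall>a. (\<forall>i<n'. i \<notin> F \<longrightarrow> a i = c' i) \<longrightarrow> R L a x' n')))" for m s t
  have "\<exists>t. P (Suc m) t \<and> Q m s t" if "P m s" for m s
  proof -
    obtain c F L where s: "s = (c, F, L)" by (cases s) auto
    then have p: "c \<in> cube A b" "finite F" "F \<subseteq> A" "F \<subseteq> {..<L}" "m \<le> L"
      using that by (auto simp: P_def)
    from fusion_step[OF R(1)[of L] R(2) p(2,3,4,1), where x = "y m" and n = "N m"]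
    obtain c' x' n' where 1: "c' \<in> cube A b" "c' \<in> cyl c L" "x' \<in> cyl (y m) (N m)" "N m \<le> n'"
      "L \<le> n'" "\<forall>a. (\<forall>i<n'. i \<notin> F \<longrightarrow> a i = c' i) \<longrightarrow> R L a x' n'" by blast
    obtain q where q: "n' \<le> q" "q \<in> A"
      using A infinite_nat_iff_unbounded_le by blast
    have "P (Suc m) (c', insert q F, Suc q)"
      using p 1(1,5) q by (auto simp: P_def)
    moreover have "Q m s (c', insert q F, Suc q)"
      unfolding Q_def s prod.case
    proof (intro conjI bexI[OF _ 1(3)] exI[of _ n'])
      show "L < Suc q" "n' < Suc q" using 1(5) q(1) by simp_all
    qed (use 1 in simp_all)
    ultimately show ?thesis by blast
  qed
  moreover have "\<exists>s. P 0 s"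
    by (rule exI[of _ "(b, {}, 0)"]) (simp add: P_def cube_def)
  ultimately obtain s where s: "\<And>m. P m (s m)" "\<And>m. Q m (s m) (s (Suc m))"
    using dependent_nat_choice[of P Q] by metis
  define c F L where "c m = fst (s m)" and "F m = fst (snd (s m))" and "L m = snd (snd (s m))" for m
  have seq: "s m = (c m, F m, L m)" for m by (simp add: c_def F_def L_def)
  have cFL: "c m \<in> cube A b" "finite (F m)" "F m \<subseteq> A" "F m \<subseteq> {..<L m}" "m \<le> L m" for m
    using s(1)[of m] unfolding P_def seq prod.case by blast+
  have step: "c (Suc m) \<in> cyl (c m) (L m)" "L m < L (Suc m)"
      "F (Suc m) = insert (L (Suc m) - 1) (F m)"
      "\<exists>x'\<in>cyl (y m) (N m). \<exists>n'\<ge>N m. L m \<le> n' \<and> n' < L (Suc m) \<and>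
        (\<forall>a. (\<forall>i<n'. i \<notin> F m \<longrightarrow> a i = c (Suc m) i) \<longrightarrow> R (L m) a x' n')" for m
    using s(2)[of m] unfolding Q_def seq prod.case by blast+
  have Lmono: "L k \<le> L m" if "k \<le> m" for k m
    using that by (rule lift_Suc_mono_le[rotated]) (simp add: step(2) less_imp_le)
  have sub: "c (m + d) \<in> cyl (c m) (L m)" for m d
  proof (induction d)
    case (Suc d)
    then show ?case
      using step(1)[of "m + d"] Lmono[of m "m + d"] by (auto simp: cyl_def)
  qed simp
  define b' where "b' i = c (Suc i) i" for i
  have b'c: "b' i = c m i" if "i < L m" for i m
  proof -
    have "i < L (Suc i)" using cFL(5)[of "Suc i"] by simp
    then show ?thesis
      using that sub[of "Suc i" "m - Suc i"] sub[of m "Suc i - m"]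
      by (cases "Suc i \<le> m") (auto simp: b'_def cyl_def)
  qed
  define A' where "A' = (\<Union>m. F m)"
  have "\<exists>i\<ge>m. i \<in> A'" for m
    using step(2)[of m] step(3)[of m] cFL(5)[of m] unfolding A'_def
    by (intro exI[of _ "L (Suc m) - 1"]) (auto intro!: exI[of _ "Suc m"])
  then have "infinite A'"
    unfolding infinite_nat_iff_unbounded_le by blast
  moreover have "A' \<subseteq> A" using cFL(3) by (auto simp: A'_def)
  moreover have "b' \<in> cube A b"
    using cFL(1) by (auto simp: b'_def cube_def)
  moreover have "\<forall>x n k. \<exists>k0\<ge>k. \<exists>z\<in>cyl x n. \<exists>l\<ge>n. k0 \<le> l \<and> A' \<inter> {k0..<l} = {} \<and>
      (\<forall>a\<in>cube A' b'. R k0 a z l)"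
  proof (intro allI)
    fix x n k
    obtain m where m: "k \<le> m" "N m = n" "y m \<in> cyl x n" using enum by blast
    obtain x' n' where n': "x' \<in> cyl (y m) (N m)" "N m \<le> n'" "L m \<le> n'" "n' < L (Suc m)"
      "\<forall>a. (\<forall>i<n'. i \<notin> F m \<longrightarrow> a i = c (Suc m) i) \<longrightarrow> R (L m) a x' n'"
      using step(4)[of m] by blast
    \<comment> \<open>Coordinates freed at stage \<open>m\<close> or later lie at or above
      \<open>n'\<close>; hence \<open>A'\<close> has a gap from \<open>L m\<close> to
      \<open>n'\<close>, and below \<open>n'\<close> the members of the final cube vary only on
      \<open>F m\<close>.\<close>
    have "F (m + d) \<subseteq> F m \<union> {n'..}" for d
    proof (induction d)
      case (Suc d)
      have "n' \<le> L (Suc (m + d)) - 1"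
        using n'(4) Lmono[of "Suc m" "Suc (m + d)"] by simp
      then show ?case using Suc step(3)[of "m + d"] by auto
    qed simp
    moreover have "F k \<subseteq> F (k + d)" for k d
      by (induction d) (use step(3) in auto)
    then have "F k \<subseteq> F m" if "k \<le> m" for k
      using le_Suc_ex[OF that] by blast
    ultimately have Fk: "F k \<subseteq> F m \<union> {n'..}" for k
      using le_Suc_ex[of m k] by (cases "k \<le> m") (blast, force)
    have A'm: "A' \<inter> {..<n'} \<subseteq> F m" using Fk by (fastforce simp: A'_def)
    have "A' \<inter> {L m..<n'} = {}"
      using A'm cFL(4)[of m] by fastforce
    moreover have "R (L m) a x' n'" if a: "a \<in> cube A' b'" for a
    proof (rule n'(5)[rule_format])
      fix i assume i: "i < n'" "i \<notin> F m"
      then have "a i = b' i" using A'm a by (auto simp: cube_def)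
      also have "\<dots> = c (Suc m) i"
        using i(1) n'(4) by (intro b'c) simp
      finally show "a i = c (Suc m) i" .
    qed
    moreover have "x' \<in> cyl x n" using n'(1) m by (auto simp: cyl_def)
    moreover have "k \<le> L m" "n \<le> n'" using m cFL(5)[of m] n'(2) by auto
    ultimately show "\<exists>k0\<ge>k. \<exists>z\<in>cyl x n. \<exists>l\<ge>n. k0 \<le> l \<and> A' \<inter> {k0..<l} = {} \<and>
        (\<forall>a\<in>cube A' b'. R k0 a z l)" using n'(3) by blast
  qed
  ultimately show ?thesis by (rule that)
qed

section \<open>Functions continuous on a generic part of a cube\<close>

text \<open>The relative Baire property is applied to each set where digit \<open>i\<close> is 1,
  and the countable families obtained are merged into one sequence \<open>G\<close>. Keeping a
  single \<open>G k\<close> inside \<open>V \<union> W\<close> lets digit \<open>i\<close> be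
  decided by entering one dense open set instead of the whole intersection.\<close>

lemma borel_relative_continuity:
  fixes f :: "'a::topological_space \<Rightarrow> cantor"
  assumes "f \<in> borel_measurable borel"
  obtains G :: "nat \<Rightarrow> 'a set" where "\<forall>k. open (G k)"
    "\<forall>k U. open U \<longrightarrow> U \<inter> Y \<noteq> {} \<longrightarrow> U \<inter> Y \<inter> G k \<noteq> {}"
    "\<forall>i. \<exists>V W k. open V \<and> open W \<and> G k \<subseteq> V \<union> W \<and>
       (\<forall>z\<in>Y \<inter> (\<Inter>k. G k). (z \<in> V \<longrightarrow> f z i) \<and> (z \<in> W \<longrightarrow> \<not> f z i))"
proof -
  have "{z. f z i} \<in> sets borel" for i
  proof -
    have "open ((\<lambda>c :: cantor. c i) -` {True})"
      by (intro open_vimage continuous_on_product_coordinates open_discrete)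
    then have "f -` ((\<lambda>c. c i) -` {True}) \<in> sets borel"
      using assms by (metis borel_open measurable_sets_borel)
    then show ?thesis by (simp add: vimage_def)
  qed
  note meas = this
  define bp where "bp i V W \<G> \<longleftrightarrow> open V \<and> open W \<and> countable \<G> \<and>
     (\<forall>G\<in>\<G>. open G \<and> (\<forall>U. open U \<longrightarrow> U \<inter> Y \<noteq> {} \<longrightarrow> U \<inter> Y \<inter> G \<noteq> {})) \<and>
     (\<exists>G\<in>\<G>. G \<subseteq> V \<union> W) \<and>
     (\<forall>z\<in>Y \<inter> \<Inter>\<G>. (z \<in> V \<longrightarrow> z \<in> {z. f z i}) \<and> (z \<in> W \<longrightarrow> z \<notin> {z. f z i}))"
    for i V W \<G>
  have "\<exists>V W \<G>. bp i V W \<G>" for i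
    unfolding bp_def by (rule borel_relative_baire_property[OF meas])
  then obtain V W \<G> where bp: "\<And>i. bp i (V i) (W i) (\<G> i)" by metis
  have VW: "open (V i)" "open (W i)" "countable (\<G> i)" "\<exists>G\<in>\<G> i. G \<subseteq> V i \<union> W i"
    "\<forall>z\<in>Y \<inter> \<Inter>(\<G> i). (z \<in> V i \<longrightarrow> f z i) \<and> (z \<in> W i \<longrightarrow> \<not> f z i)" for i
    using bp[of i] unfolding bp_def by simp_all
  have dense: "open H" "open U \<Longrightarrow> U \<inter> Y \<noteq> {} \<Longrightarrow> U \<inter> Y \<inter> H \<noteq> {}" if "H \<in> \<G> i" for i H U
    using bp[of i] that unfolding bp_def by blast+
  define G where "G = from_nat_into (\<Union>i. \<G> i)"
  have ne: "(\<Union>i. \<G> i) \<noteq> {}" using VW(4)[of 0] by blast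
  have rG: "range G = (\<Union>i. \<G> i)"
    unfolding G_def using ne VW(3) by (intro range_from_nat_into) auto
  have "open (G k)" "open U \<Longrightarrow> U \<inter> Y \<noteq> {} \<Longrightarrow> U \<inter> Y \<inter> G k \<noteq> {}" for k U
  proof -
    have "G k \<in> (\<Union>i. \<G> i)" using rG by blast
    then obtain i where "G k \<in> \<G> i" by blast
    then show "open (G k)" "open U \<Longrightarrow> U \<inter> Y \<noteq> {} \<Longrightarrow> U \<inter> Y \<inter> G k \<noteq> {}"
      using dense by blast+
  qed
  moreover have "\<exists>V W k. open V \<and> open W \<and> G k \<subseteq> V \<union> W \<and>
       (\<forall>z\<in>Y \<inter> (\<Inter>k. G k). (z \<in> V \<longrightarrow> f z i) \<and> (z \<in> W \<longrightarrow> \<not> f z i))" for i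
  proof -
    obtain H where H: "H \<in> \<G> i" "H \<subseteq> V i \<union> W i" using VW(4) by blast
    then have "H \<in> range G" using rG by blast
    then obtain k where k: "H = G k" by (rule rangeE)
    have "\<G> i \<subseteq> range G" unfolding rG by (rule UN_upper) simp
    then have "\<Inter>(range G) \<subseteq> \<Inter>(\<G> i)" by (rule Inter_anti_mono)
    then have sub: "Y \<inter> (\<Inter>k. G k) \<subseteq> Y \<inter> \<Inter>(\<G> i)" by (rule Int_mono[OF subset_refl])
    show ?thesis
    proof (intro exI conjI ballI)
      show "open (V i)" "open (W i)" using VW by simp_all
      show "G k \<subseteq> V i \<union> W i" using H(2) k by simp
      fix z assume "z \<in> Y \<inter> (\<Inter>k. G k)"
      from VW(5)[THEN bspec, OF subsetD[OF sub this]]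
      show "z \<in> V i \<longrightarrow> f z i" "z \<in> W i \<longrightarrow> \<not> f z i" by simp_all
    qed
  qed
  ultimately show ?thesis by (intro that allI impI)
qed

text \<open>Prepares the counting against at most \<open>2 ^ L\<close> values of the function. Level
  \<open>L\<close> serves only the indices \<open>n \<le> L\<close>, so a maximum over finitely many
  bounds suffices.\<close>

lemma ex_card_interval_ge:
  assumes "\<And>n. infinite (B n :: nat set)"
  shows "\<exists>p. \<forall>L. \<forall>n\<le>L. 2 ^ L \<le> card (B n \<inter> {L..<p L})"
proof -
  have "\<exists>p. \<forall>n\<le>L. 2 ^ L \<le> card (B n \<inter> {L..<p})" for L
  proof -
    have "\<exists>p. 2 ^ L \<le> card (B n \<inter> {L..<p})" for n
    proof -
      have "infinite (B n - {..<L})" using assms by (simp add: Diff_infinite_finite)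
      then obtain K where K: "finite K" "card K = 2 ^ L" "K \<subseteq> B n - {..<L}"
        using infinite_arbitrarily_large by metis
      obtain p where "\<forall>i\<in>K. i < p" using K(1) finite_nat_set_iff_bounded by blast
      then have "K \<subseteq> B n \<inter> {L..<p}" using K(3) by auto
      then show ?thesis using K(2) by (metis card_mono finite_Int finite_atLeastLessThan)
    qed
    then obtain p where p: "\<And>n. 2 ^ L \<le> card (B n \<inter> {L..<p n})" by metis
    have "2 ^ L \<le> card (B n \<inter> {L..<Max (p ` {..L})})" if "n \<le> L" for n
    proof -
      have "p n \<le> Max (p ` {..L})" using that by simp
      then have "B n \<inter> {L..<p n} \<subseteq> B n \<inter> {L..<Max (p ` {..L})}" by auto
      then have "card (B n \<inter> {L..<p n}) \<le> card (B n \<inter> {L..<Max (p ` {..L})})"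
        by (intro card_mono) auto
      then show ?thesis using p le_trans by blast
    qed
    then show ?thesis by blast
  qed
  then show ?thesis by metis
qed

section \<open>Dense requirements on boxes for a function continuous on a generic set\<close>

locale generic_function =
  fixes A :: "nat set" and b :: cantor and f :: "cantor \<times> baire \<Rightarrow> cantor"
    and G :: "nat \<Rightarrow> (cantor \<times> baire) set"
  assumes infinite_A: "infinite A"
    and open_G: "open (G k)"
    and dense_G: "open U \<Longrightarrow> U \<inter> (cube A b \<times> UNIV) \<noteq> {} \<Longrightarrow> U \<inter> (cube A b \<times> UNIV) \<inter> G k \<noteq> {}"
    and decided_G: "\<exists>V W k. open V \<and> open W \<and> G k \<subseteq> V \<union> W \<and>
      (\<forall>z\<in>cube A b \<times> UNIV \<inter> (\<Inter>k. G k). (z \<in> V \<longrightarrow> f z i) \<and> (z \<in> W \<longrightarrow> \<not> f z i))"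
begin

definition D :: "(cantor \<times> baire) set" where
  "D = cube A b \<times> UNIV \<inter> (\<Inter>k. G k)"

definition inside :: "nat \<Rightarrow> cantor \<Rightarrow> baire \<Rightarrow> nat \<Rightarrow> bool" where
  "inside k a x n \<longleftrightarrow> (cube A b \<times> UNIV) \<inter> (cyl a n \<times> cyl x n) \<subseteq> G k"

definition decided :: "nat \<Rightarrow> cantor \<Rightarrow> baire \<Rightarrow> nat \<Rightarrow> bool" where
  "decided i a x n \<longleftrightarrow> (\<exists>v. \<forall>z\<in>D \<inter> (cyl a n \<times> cyl x n). f z i = v)"

text \<open>Fusion leaves the interval from \<open>L\<close> to \<open>n\<close> free of splitting
  levels, so a disagreement at \<open>p\<close> in it occurs at a digit shared by all branches of
  the new tree.\<close>

definition moved :: "nat \<Rightarrow> cantor \<Rightarrow> baire \<Rightarrow> nat \<Rightarrow> bool" where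
  "moved L a x n \<longleftrightarrow> (\<exists>p\<in>{L..<n}. \<forall>z\<in>D \<inter> (cyl a n \<times> cyl x n). f z p \<noteq> fst z p)"

lemma box_mono:
  "n \<le> n' \<Longrightarrow> a' \<in> cyl a n \<Longrightarrow> x' \<in> cyl x n \<Longrightarrow> cyl a' n' \<times> cyl x' n' \<subseteq> cyl a n \<times> cyl x n"
  using cyl_mono[of a' a n n'] cyl_mono[of x' x n n'] by blast

lemma persistent_inside: "persistent (inside k)"
  unfolding persistent_def
proof (intro allI impI)
  fix a x n a' x' n' assume "inside k a x n" "n \<le> n'" "a' \<in> cyl a n" "x' \<in> cyl x n"
  then show "inside k a' x' n'"
    using box_mono[of n n' a' a x' x] unfolding inside_def by blast
qed

lemma persistent_decided: "persistent (decided i)"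
  unfolding persistent_def
proof (intro allI impI)
  fix a x n a' x' n' assume "decided i a x n" "n \<le> n'" "a' \<in> cyl a n" "x' \<in> cyl x n"
  then show "decided i a' x' n'"
    using box_mono[of n n' a' a x' x] unfolding decided_def by blast
qed

lemma persistent_moved: "persistent (moved L)"
  unfolding persistent_def
proof (intro allI impI)
  fix a x n a' x' n' assume *: "moved L a x n" "n \<le> n'" "a' \<in> cyl a n" "x' \<in> cyl x n"
  then obtain p where "p \<in> {L..<n}" "\<forall>z\<in>D \<inter> (cyl a n \<times> cyl x n). f z p \<noteq> fst z p"
    unfolding moved_def by blast
  moreover have "p \<in> {L..<n'}" using calculation(1) *(2) by simp
  ultimately show "moved L a' x' n'"
    using box_mono[of n n' a' a x' x] * unfolding moved_def by blast
qed

lemma dense_point: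
  assumes "a \<in> cube A b"
  obtains a' x' where "a' \<in> cube A b" "a' \<in> cyl a n" "x' \<in> cyl x n" "(a', x') \<in> G k"
proof -
  have "(a, x) \<in> (cyl a n \<times> cyl x n) \<inter> (cube A b \<times> UNIV)" using assms by simp
  moreover have "open (cyl a n \<times> cyl x n)" by (intro open_Times open_cyl)
  ultimately have "(cyl a n \<times> cyl x n) \<inter> (cube A b \<times> UNIV) \<inter> G k \<noteq> {}"
    using dense_G by blast
  then show ?thesis using that by blast
qed

lemma dense_inside: "dense_on (cube A b) (inside k)"
  unfolding dense_on_def
proof (intro ballI allI)
  fix a x n assume "a \<in> cube A b"
  then obtain a' x' where 1: "a' \<in> cube A b" "a' \<in> cyl a n" "x' \<in> cyl x n" "(a', x') \<in> G k"
    using dense_point by metis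
  obtain n' where "n' \<ge> n" "cyl a' n' \<times> cyl x' n' \<subseteq> G k"
    using open_contains_box[OF open_G 1(4)] by blast
  then show "\<exists>a'\<in>cube A b \<inter> cyl a n. \<exists>x'\<in>cyl x n. \<exists>n'\<ge>n. inside k a' x' n'"
    using 1 unfolding inside_def by blast
qed

text \<open>A point of \<open>V\<close> or \<open>W\<close> has a whole box inside that open set,
  and on the generic part of the box the digit is constant.\<close>

lemma eventually_decided:
  "\<exists>k. \<forall>a x n. (a, x) \<in> G k \<longrightarrow> (\<exists>n'\<ge>n. decided i a x n')"
proof -
  obtain V W k where VW: "open V" "open W" "G k \<subseteq> V \<union> W"
    "\<forall>z\<in>D. (z \<in> V \<longrightarrow> f z i) \<and> (z \<in> W \<longrightarrow> \<not> f z i)"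
    using decided_G[of i] unfolding D_def by blast
  have "\<exists>n'\<ge>n. decided i a x n'" if ax: "(a, x) \<in> G k" for a x n
  proof -
    consider "(a, x) \<in> V" | "(a, x) \<in> W" using ax VW(3) by blast
    then show ?thesis
    proof cases
      case 1
      then obtain n' where "n' \<ge> n" "cyl a n' \<times> cyl x n' \<subseteq> V"
        using open_contains_box[OF VW(1)] by blast
      then show ?thesis using VW(4) unfolding decided_def by blast
    next
      case 2
      then obtain n' where "n' \<ge> n" "cyl a n' \<times> cyl x n' \<subseteq> W"
        using open_contains_box[OF VW(2)] by blast
      then show ?thesis using VW(4) unfolding decided_def by blast
    qed
  qed
  then show ?thesis by blast
qed

lemma decided_at_D:
  assumes "(a, x) \<in> D"
  shows "\<exists>n'\<ge>n. decided i a x n'"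
  using eventually_decided[of i] assms unfolding D_def by blast

lemma dense_decided: "dense_on (cube A b) (decided i)"
  unfolding dense_on_def
proof (intro ballI allI)
  fix a x n assume a: "a \<in> cube A b"
  obtain k where k: "\<And>a x n. (a, x) \<in> G k \<Longrightarrow> \<exists>n'\<ge>n. decided i a x n'"
    using eventually_decided by blast
  obtain a' x' where 1: "a' \<in> cube A b" "a' \<in> cyl a n" "x' \<in> cyl x n" "(a', x') \<in> G k"
    using dense_point[OF a] by metis
  then show "\<exists>a'\<in>cube A b \<inter> cyl a n. \<exists>x'\<in>cyl x n. \<exists>n'\<ge>n. decided i a' x' n'"
    using k[OF 1(4), of n] by blast
qed

text \<open>One point of disagreement is enough: deciding digit \<open>p\<close> there, on a box
  longer than \<open>p\<close>, spreads the disagreement over the generic part of the box.\<close>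

lemma dense_moved:
  assumes "\<And>a x n L. a \<in> cube A b \<Longrightarrow>
    \<exists>z\<in>D \<inter> (cyl a n \<times> cyl x n). \<exists>p\<ge>L. f z p \<noteq> fst z p"
  shows "dense_on (cube A b) (moved L)"
  unfolding dense_on_def
proof (intro ballI allI)
  fix a x n assume "a \<in> cube A b"
  then obtain z p where zp: "z \<in> D \<inter> (cyl a n \<times> cyl x n)" "p \<ge> L" "f z p \<noteq> fst z p"
    using assms[of a n x L] by blast
  obtain a' x' where z: "z = (a', x')" by (cases z)
  have 1: "(a', x') \<in> D" "a' \<in> cyl a n" "x' \<in> cyl x n" "p \<ge> L" "f (a', x') p \<noteq> a' p"
    using zp by (simp_all add: z)
  obtain n' where n': "n' \<ge> max n (Suc p)" "decided p a' x' n'"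
    using decided_at_D[OF 1(1)] by blast
  have "f z p \<noteq> fst z p" if z: "z \<in> D \<inter> (cyl a' n' \<times> cyl x' n')" for z
  proof -
    have "f z p = f (a', x') p"
      using n'(2) z 1(1) unfolding decided_def by (metis IntI SigmaI cyl_self)
    moreover have "fst z p = a' p" using z n'(1) by (auto simp: cyl_def)
    ultimately show ?thesis using 1(5) by simp
  qed
  moreover have "p \<in> {L..<n'}" using 1 n' by auto
  ultimately have "moved L a' x' n'" unfolding moved_def by blast
  moreover have "a' \<in> cube A b" using 1(1) by (simp add: D_def)
  ultimately show "\<exists>a'\<in>cube A b \<inter> cyl a n. \<exists>x'\<in>cyl x n. \<exists>n'\<ge>n. moved L a' x' n'"
    using 1 n'(1) by (meson IntI max.boundedE)
qed

lemma continuous_on_D: "continuous_on D f"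
proof (rule continuous_on_coordinatewise_then_product)
  fix i
  show "continuous_on D (\<lambda>z. f z i)"
    unfolding continuous_on_topological
  proof (intro ballI allI impI)
    fix z B assume z: "z \<in> D" "f z i \<in> B"
    obtain a x where ax: "z = (a, x)" by (cases z)
    obtain n where n: "decided i a x n" using decided_at_D z ax by blast
    have "\<forall>w\<in>D. w \<in> cyl a n \<times> cyl x n \<longrightarrow> f w i \<in> B"
    proof (intro ballI impI)
      fix w assume "w \<in> D" "w \<in> cyl a n \<times> cyl x n"
      then have "f w i = f z i"
        using n z(1) unfolding decided_def ax by (metis IntI SigmaI cyl_self)
      then show "f w i \<in> B" using z(2) by simp
    qed
    then show "\<exists>U. open U \<and> z \<in> U \<and> (\<forall>w\<in>D. w \<in> U \<longrightarrow> f w i \<in> B)"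
      by (intro exI[of _ "cyl a n \<times> cyl x n"] conjI open_Times open_cyl) (simp_all add: ax)
  qed
qed

text \<open>\<open>X\<close> collects the points meeting each \<open>inside\<close> requirement for
  all branches of the subcube at once, so that its product with the subcube falls into
  \<open>D\<close>; the slot \<open>Q\<close> takes countably many further conditions.\<close>

lemma generic_fibre:
  fixes Q :: "'i::countable \<Rightarrow> baire \<Rightarrow> nat \<Rightarrow> bool"
  assumes "A' \<subseteq> A" "b' \<in> cube A b"
    and ins: "\<And>x n k. \<exists>x'\<in>cyl x n. \<exists>n'\<ge>n. \<forall>a\<in>cube A' b'. inside k a x' n'"
    and Q: "\<And>x n i. \<exists>x'\<in>cyl x n. \<exists>n'\<ge>n. Q i x' n'"
  obtains X where "gdelta X" "closure X = UNIV" "cube A' b' \<times> X \<subseteq> D"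
    "continuous_on (cube A' b' \<times> X) f"
    "\<forall>y\<in>X. \<forall>i. \<exists>x n. y \<in> cyl x n \<and> Q i x n"
proof -
  define Q' :: "nat + 'i \<Rightarrow> baire \<Rightarrow> nat \<Rightarrow> bool" where
    "Q' = case_sum (\<lambda>k x n. \<forall>a\<in>cube A' b'. inside k a x n) Q"
  define X where "X = {y. \<forall>i. \<exists>x n. y \<in> cyl x n \<and> Q' i x n}"
  have "\<exists>x'\<in>cyl x n. \<exists>n'\<ge>n. Q' i x' n'" for i x n
    using ins Q by (cases i) (auto simp: Q'_def)
  then have "gdelta X" "closure X = UNIV"
    using dense_gdelta_of_cyls[of Q'] unfolding X_def by blast+
  moreover have sub: "cube A' b' \<times> X \<subseteq> D"
  proof clarify
    fix a y assume a: "a \<in> cube A' b'" and y: "y \<in> X"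
    have aC: "a \<in> cube A b" using a cube_subset assms(1,2) by blast
    have "(a, y) \<in> G k" for k
    proof -
      obtain x n where "y \<in> cyl x n" "Q' (Inl k) x n" using y unfolding X_def by blast
      moreover from this(2) have "cube A b \<times> UNIV \<inter> cyl a n \<times> cyl x n \<subseteq> G k"
        using a by (simp add: Q'_def inside_def)
      ultimately show ?thesis using aC by (auto dest!: subsetD)
    qed
    then show "(a, y) \<in> D" using aC by (simp add: D_def)
  qed
  moreover have "continuous_on (cube A' b' \<times> X) f"
    using continuous_on_D sub continuous_on_subset by blast
  moreover have "\<forall>y\<in>X. \<forall>i. \<exists>x n. y \<in> cyl x n \<and> Q i x n"
  proof (intro ballI allI)
    fix y i assume "y \<in> X"
    then obtain x n where "y \<in> cyl x n" "Q' (Inr i) x n" unfolding X_def by blast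
    then show "\<exists>x n. y \<in> cyl x n \<and> Q i x n" by (auto simp: Q'_def)
  qed
  ultimately show ?thesis by (rule that)
qed

section \<open>The case of a shift on some box\<close>

lemma normalized_shift:
  assumes a: "a \<in> cube A b"
    and eq: "\<forall>z\<in>D \<inter> (cyl a n \<times> cyl x n). \<forall>p\<ge>L. f z p = fst z p"
  shows "\<exists>A' b'. infinite A' \<and> A' \<subseteq> A \<and> b' \<in> cube A b \<and>
    (\<forall>U. normalized_on f (cube_tree A' b') U)"
proof -
  have "dense_on (cube A b) (\<lambda>a x n. \<forall>i<L. decided i a x n)"
    by (intro dense_on_all_less persistent_decided dense_decided)
  from dense_onE[OF this a, where x = x and n = "max n L"]
  obtain a1 x1 m where 1: "a1 \<in> cube A b" "a1 \<in> cyl a (max n L)" "x1 \<in> cyl x (max n L)"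
    "max n L \<le> m" "\<forall>i<L. decided i a1 x1 m" by blast
  \<comment> \<open>Dropping the splitting levels below \<open>m\<close> confines all branches to
    \<open>cyl a1 m\<close>, the first factor of a box on which the first \<open>L\<close> digits of
    the function are decided.\<close>
  define A1 where "A1 = A - {..<m}"
  have A1: "infinite A1" using infinite_A by (simp add: A1_def Diff_infinite_finite)
  have A1sub: "cube A1 a1 \<subseteq> cube A b" using 1(1) by (intro cube_subset) (auto simp: A1_def)
  define R where "R L a x n \<longleftrightarrow> (\<forall>k<Suc L. inside k a x n)" for L a x n
  have pR: "persistent (R L)" for L
    unfolding R_def by (intro persistent_all_less persistent_inside)
  have dR0: "dense_on (cube A b) (R L)" for L
    unfolding R_def by (intro dense_on_all_less persistent_inside dense_inside)
  \<comment> \<open>Density passes to the smaller cube: a box of length at least \<open>m\<close>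
    keeps the digits below \<open>m\<close>, and from \<open>m\<close> on the two cubes impose the
    same condition.\<close>
  have dR: "dense_on (cube A1 a1) (R L)" for L
    unfolding dense_on_def
  proof (intro ballI allI)
    fix c y l assume c: "c \<in> cube A1 a1"
    then obtain c' y' l' where 2: "c' \<in> cube A b" "c' \<in> cyl c (max l m)" "y' \<in> cyl y (max l m)"
      "max l m \<le> l'" "R L c' y' l'"
      using dense_onE[OF dR0] A1sub by blast
    have "c' \<in> cube A1 a1"
      using 2(1,2) 1(1) c by (auto simp: cube_def cyl_def A1_def)
    moreover have "c' \<in> cyl c l" "y' \<in> cyl y l" "l \<le> l'" using 2 by (auto simp: cyl_def)
    ultimately show "\<exists>a'\<in>cube A1 a1 \<inter> cyl c l. \<exists>x'\<in>cyl y l. \<exists>n'\<ge>l. R L a' x' n'"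
      using 2(5) by blast
  qed
  obtain A' b' where fus: "infinite A'" "A' \<subseteq> A1" "b' \<in> cube A1 a1"
    "\<forall>x n k. \<exists>L\<ge>k. \<exists>x'\<in>cyl x n. \<exists>n'\<ge>n. L \<le> n' \<and> A' \<inter> {L..<n'} = {} \<and>
       (\<forall>a\<in>cube A' b'. R L a x' n')"
    by (rule fusion[where R = R, OF A1 pR dR])
  have sub: "cube A' b' \<subseteq> cube A1 a1" using fus cube_subset by blast
  have A'A: "A' \<subseteq> A" "b' \<in> cube A b" using fus A1sub by (auto simp: A1_def)
  have ins: "\<exists>x'\<in>cyl x n. \<exists>n'\<ge>n. \<forall>a\<in>cube A' b'. inside k a x' n'" for x n k
  proof -
    obtain L x' n' where L: "L \<ge> k" "x' \<in> cyl x n" "n' \<ge> n" "\<forall>a\<in>cube A' b'. R L a x' n'"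
      using fus(4)[rule_format, where x = x and n = n and k = k] by blast
    then have "\<forall>a\<in>cube A' b'. inside k a x' n'" by (simp add: R_def)
    then show ?thesis using L(2,3) by blast
  qed
  obtain X where X: "gdelta X" "closure X = UNIV" "cube A' b' \<times> X \<subseteq> D"
    "continuous_on (cube A' b' \<times> X) f"
    by (rule generic_fibre[OF A'A ins, of "\<lambda>_::nat. \<lambda>_ _. True"]) (blast intro: cyl_self)+
  obtain v where v: "\<And>i z. i < L \<Longrightarrow> z \<in> D \<inter> (cyl a1 m \<times> cyl x1 m) \<Longrightarrow> f z i = v i"
    using 1(5) unfolding decided_def by metis
  \<comment> \<open>Below \<open>L \<le> m\<close> every branch agrees with \<open>a1\<close>, so
    one finite sequence turns its digits into the decided values \<open>v\<close>.\<close>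
  define \<sigma> where "\<sigma> = map (\<lambda>i. a1 i \<noteq> v i) [0..<L]"
  have "f (c, y) = shift \<sigma> c"
    if c: "c \<in> cube A' b'" and y: "y \<in> baire_nbhd (map x1 [0..<m]) \<inter> X" for c y
  proof
    fix i
    have "c \<in> cyl a1 m" using c sub by (auto simp: cube_def cyl_def A1_def)
    moreover have "y \<in> cyl x1 m" using y by (auto simp: baire_nbhd_def cyl_def)
    ultimately have z: "(c, y) \<in> D \<inter> (cyl a1 m \<times> cyl x1 m)" using X(3) c y by blast
    moreover have "cyl a1 m \<times> cyl x1 m \<subseteq> cyl a n \<times> cyl x n"
      using 1 by (intro box_mono) (auto simp: cyl_def)
    ultimately have z': "(c, y) \<in> D \<inter> (cyl a n \<times> cyl x n)" by blast
    show "f (c, y) i = shift \<sigma> c i"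
    proof (cases "i < L")
      case True
      then have "c i = a1 i" using z 1(4) by (auto simp: cyl_def)
      then show ?thesis using v[OF True z] True by (auto simp: shift_def \<sigma>_def)
    next
      case False
      then show ?thesis using eq[rule_format, OF z', of i] by (simp add: shift_def \<sigma>_def)
    qed
  qed
  then have "normalized_on f (cube_tree A' b') U" for U
    unfolding normalized_on_def branches_cube_tree using X by blast
  then show ?thesis using fus(1) A'A by blast
qed

section \<open>The case of avoiding all shifts\<close>

definition avoids :: "cantor set \<Rightarrow> nat set \<Rightarrow> cantor \<Rightarrow> bool" where
  "avoids C B e \<longleftrightarrow> (\<forall>x n k. \<exists>x'\<in>cyl x n. \<exists>n'\<ge>n. \<forall>a\<in>C. \<forall>y\<in>cyl x' n'.
     (a, y) \<in> D \<longrightarrow> (\<exists>p\<ge>k. p \<notin> B \<and> f (a, y) p \<noteq> e p))"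

text \<open>A shift by \<open>\<sigma>\<close> alters only digits below
  \<open>length \<sigma>\<close>, so a disagreement with \<open>e m\<close> off \<open>B m\<close>
  at or beyond that length excludes membership in the shifted cube. Countably many pairs
  \<open>(m, k)\<close> cover all trees and all lengths.\<close>

lemma normalized_avoids:
  assumes A': "A' \<subseteq> A" "b' \<in> cube A b"
    and ins: "\<And>x n k. \<exists>x'\<in>cyl x n. \<exists>n'\<ge>n. \<forall>a\<in>cube A' b'. inside k a x' n'"
    and av: "\<And>m::nat. avoids (cube A' b') (B m) (e m)"
  shows "normalized_on f (cube_tree A' b') (range (\<lambda>m. cube_tree (B m) (e m)))"
proof -
  define Q where "Q = (\<lambda>(m, k) x n. \<forall>a\<in>cube A' b'. \<forall>y\<in>cyl x n.
     (a, y) \<in> D \<longrightarrow> (\<exists>p\<ge>k. p \<notin> B m \<and> f (a, y) p \<noteq> e m p))"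
  have Qd: "\<exists>x'\<in>cyl x n. \<exists>n'\<ge>n. Q i x' n'" for i x n
    using av unfolding Q_def avoids_def by (cases i) simp
  obtain X where X: "gdelta X" "closure X = UNIV" "cube A' b' \<times> X \<subseteq> D"
    "continuous_on (cube A' b' \<times> X) f" "\<forall>y\<in>X. \<forall>i. \<exists>x n. y \<in> cyl x n \<and> Q i x n"
    by (rule generic_fibre[where Q = Q, OF A' ins Qd])
  have "f (a, y) \<notin> shift \<sigma> ` cube (B m) (e m)" if a: "a \<in> cube A' b'" and y: "y \<in> X" for a y \<sigma> m
  proof
    assume "f (a, y) \<in> shift \<sigma> ` cube (B m) (e m)"
    then obtain c where c: "c \<in> cube (B m) (e m)" "f (a, y) = shift \<sigma> c" by blast
    obtain x n where "y \<in> cyl x n" "Q (m, length \<sigma>) x n" using X(5) y by blast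
    moreover have "(a, y) \<in> D" using X(3) a y by blast
    ultimately obtain p where p: "p \<ge> length \<sigma>" "p \<notin> B m" "f (a, y) p \<noteq> e m p"
      using a unfolding Q_def prod.case by blast
    then show False using c by (simp add: shift_def cube_def)
  qed
  then show ?thesis
    unfolding normalized_on_def using X
    by (intro exI[of _ X]) (auto simp: branches_cube_tree)
qed

text \<open>
  Below \<open>n'\<close> the members of \<open>cube A' b'\<close> are determined by their first \<open>L\<close> digits, so on the
  chosen neighbourhood the function takes at most \<open>2 ^ L\<close> values up to \<open>p L\<close>; there are enough
  free coordinates of \<open>cube B e\<close> between \<open>L\<close> and \<open>p L\<close> to differ from each of them.
\<close>

lemma ex_avoiding_subcube:
  fixes p :: "nat \<Rightarrow> nat"
  assumes B: "infinite B"
    and dec: "\<And>x n k. \<exists>L\<ge>k. \<exists>x'\<in>cyl x n. \<exists>n'\<ge>n. L \<le> n' \<and> A' \<inter> {L..<n'} = {} \<and>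
       (\<forall>a\<in>cube A' b'. \<forall>i<p L. decided i a x' n')"
    and card: "\<And>L. m \<le> L \<Longrightarrow> 2 ^ L \<le> card (B \<inter> {L..<p L})"
  shows "\<exists>B' e'. infinite B' \<and> B' \<subseteq> B \<and> e' \<in> cube B e \<and> avoids (cube A' b') B' e'"
proof -
  \<comment> \<open>The fusion runs over \<open>c\<close> in \<open>cube B e\<close>, the cube being
    thinned; the branches \<open>a\<close> of the fixed cube are quantified inside the
    requirement.\<close>
  define R where "R L c x n \<longleftrightarrow> (\<forall>a\<in>cube A' b'. \<forall>y\<in>cyl x n.
    (a, y) \<in> D \<longrightarrow> (\<exists>q\<in>{L..<n}. f (a, y) q \<noteq> c q))" for L c x n
  have pR: "persistent (R L)" for L
    unfolding persistent_def
  proof (intro allI impI)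
    fix c :: cantor and x n c' x' n'
    assume *: "R L c x n" "n \<le> n'" "c' \<in> cyl c n" "x' \<in> cyl x n"
    show "R L c' x' n'"
      unfolding R_def
    proof (intro ballI impI)
      fix a y assume a: "a \<in> cube A' b'" and y: "y \<in> cyl x' n'" and D: "(a, y) \<in> D"
      have "y \<in> cyl x n" using y * cyl_mono[of x' x n n'] by blast
      then obtain q where "q \<in> {L..<n}" "f (a, y) q \<noteq> c q"
        using *(1) a D unfolding R_def by blast
      then show "\<exists>q\<in>{L..<n'}. f (a, y) q \<noteq> c' q"
        using * by (intro bexI[of _ q]) (auto simp: cyl_def)
    qed
  qed
  have dR: "dense_on (cube B e) (R L0)" for L0
    unfolding dense_on_def
  proof (intro ballI allI)
    fix c x n assume c: "c \<in> cube B e"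
    \<comment> \<open>\<open>L\<close> is at least \<open>n\<close>, so that changing
      \<open>c\<close> from \<open>L\<close> on stays in \<open>cyl c n\<close>; at least
      \<open>L0\<close>, where disagreement is wanted; and at least \<open>m\<close>, so that the
      count applies.\<close>
    obtain L x' n' where L: "L \<ge> max n (max L0 m)" "x' \<in> cyl x n" "n' \<ge> n" "L \<le> n'"
      "A' \<inter> {L..<n'} = {}" "\<And>a i. a \<in> cube A' b' \<Longrightarrow> i < p L \<Longrightarrow> decided i a x' n'"
      using dec[where x = x and n = n and k = "max n (max L0 m)"] by blast
    define val where "val a y = {i. i < p L \<and> f (a, y) i}" for a y
    define key where "key a = {i. i < L \<and> a i}" for a :: cantor
    define Z where "Z = {(a, y). a \<in> cube A' b' \<and> y \<in> cyl x' n' \<and> (a, y) \<in> D}"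
    define V where "V = (\<lambda>(a, y). val a y) ` Z"
    have wd: "val a y = val a' y'" if "(a, y) \<in> Z" "(a', y') \<in> Z" "key a = key a'" for a y a' y'
    proof -
      have "a i = a' i" if "i < n'" for i
      proof (cases "i < L")
        case True
        then show ?thesis using \<open>key a = key a'\<close> unfolding key_def by blast
      next
        case False
        then have "i \<notin> A'" using L(5) that by auto
        then show ?thesis
          using \<open>(a, y) \<in> Z\<close> \<open>(a', y') \<in> Z\<close> by (auto simp: Z_def cube_def)
      qed
      then have "(a', y') \<in> D \<inter> (cyl a n' \<times> cyl x' n')" "(a, y) \<in> D \<inter> (cyl a n' \<times> cyl x' n')"
        using that by (auto simp: Z_def cyl_def)
      moreover have "decided i a x' n'" if "i < p L" for i
        using L(6) that \<open>(a, y) \<in> Z\<close> by (auto simp: Z_def)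
      ultimately have "f (a, y) i = f (a', y') i" if "i < p L" for i
        using that unfolding decided_def by metis
      then show ?thesis by (auto simp: val_def)
    qed
    \<comment> \<open>One generic pair is chosen per key; by \<open>wd\<close> the choice does not
      affect the value, so there are at most as many values as keys.\<close>
    define h where "h s = (case SOME z. z \<in> Z \<and> key (fst z) = s of (a, y) \<Rightarrow> val a y)" for s
    have "V \<subseteq> h ` Pow {..<L}"
    proof
      fix v assume "v \<in> V"
      then obtain a y where ay: "(a, y) \<in> Z" "v = val a y" by (auto simp: V_def)
      define z where "z = (SOME z. z \<in> Z \<and> key (fst z) = key a)"
      have "z \<in> Z \<and> key (fst z) = key a"
        unfolding z_def by (rule someI[of _ "(a, y)"]) (use ay in simp)
      then have "h (key a) = v"
        unfolding h_def z_def[symmetric] using wd[OF _ ay(1)] ay(2) by (cases z) auto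
      moreover have "key a \<in> Pow {..<L}" by (auto simp: key_def)
      ultimately show "v \<in> h ` Pow {..<L}" by blast
    qed
    then have finV: "finite V" and "card V \<le> card (Pow {..<L})"
      using finite_subset card_mono card_image_le
      by (blast, meson finite_Pow_iff finite_imageI finite_lessThan le_trans card_mono card_image_le)
    then have "card V \<le> card (B \<inter> {L..<p L})"
      using card[of L] L(1) by (simp add: card_Pow)
    then obtain j where j: "j ` V \<subseteq> B \<inter> {L..<p L}" "inj_on j V"
      using card_le_inj[OF finV, of "B \<inter> {L..<p L}"] by auto
    \<comment> \<open>Each value \<open>v\<close> gets its own coordinate \<open>j v\<close>, where
      \<open>c'\<close> takes the digit opposite to that of \<open>v\<close>.\<close>
    define c' where "c' q = (if q \<in> j ` V then q \<notin> inv_into V j q else c q)" for q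
    have c'j: "c' (j v) \<longleftrightarrow> j v \<notin> v" if "v \<in> V" for v
      using that j(2) by (simp add: c'_def)
    have "c' \<in> cube B e" using c j(1) by (auto simp: cube_def c'_def)
    moreover have "c' \<in> cyl c n"
      using L(1) j(1) by (fastforce simp: cyl_def c'_def)
    moreover have "R L0 c' x' (max n' (p L))"
      unfolding R_def
    proof (intro ballI impI)
      fix a y assume a: "a \<in> cube A' b'" and y: "y \<in> cyl x' (max n' (p L))" and D: "(a, y) \<in> D"
      have "(a, y) \<in> Z" using a y D by (auto simp: Z_def cyl_def)
      then have v: "val a y \<in> V" by (force simp: V_def)
      then have jv: "j (val a y) \<in> {L..<p L}" using j(1) by blast
      then have "f (a, y) (j (val a y)) \<noteq> c' (j (val a y))"
        using c'j[OF v] by (auto simp: val_def)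
      then show "\<exists>q\<in>{L0..<max n' (p L)}. f (a, y) q \<noteq> c' q"
        using jv L(1) by (intro bexI[of _ "j (val a y)"]) auto
    qed
    ultimately show "\<exists>a'\<in>cube B e \<inter> cyl c n. \<exists>x'\<in>cyl x n. \<exists>n'\<ge>n. R L0 a' x' n'"
      using L(2,3) by (meson IntI max.coboundedI1)
  qed
  obtain B' e' where fus: "infinite B'" "B' \<subseteq> B" "e' \<in> cube B e"
    "\<forall>x n k. \<exists>L\<ge>k. \<exists>x'\<in>cyl x n. \<exists>n'\<ge>n. L \<le> n' \<and> B' \<inter> {L..<n'} = {} \<and>
       (\<forall>c\<in>cube B' e'. R L c x' n')"
    by (rule fusion[where R = R, OF B pR dR])
  have "avoids (cube A' b') B' e'"
    unfolding avoids_def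
  proof (intro allI)
    fix x n k
    obtain L x' n' where L: "L \<ge> k" "x' \<in> cyl x n" "n' \<ge> n" "B' \<inter> {L..<n'} = {}"
      "\<forall>c\<in>cube B' e'. R L c x' n'"
      using fus(4)[rule_format, where x = x and n = n and k = k] by blast
    have "R L e' x' n'" using L(5) by (simp add: cube_def)
    have "\<exists>p\<ge>k. p \<notin> B' \<and> f (a, y) p \<noteq> e' p"
      if ay: "a \<in> cube A' b'" "y \<in> cyl x' n'" "(a, y) \<in> D" for a y
    proof -
      obtain q where q: "q \<in> {L..<n'}" "f (a, y) q \<noteq> e' q"
        using \<open>R L e' x' n'\<close> ay unfolding R_def by blast
      then have "q \<notin> B'" "q \<ge> k" using L(1,4) by auto
      then show ?thesis using q(2) by blast
    qed
    then show "\<exists>x'\<in>cyl x n. \<exists>n'\<ge>n. \<forall>a\<in>cube A' b'. \<forall>y\<in>cyl x' n'. (a, y) \<in> D \<longrightarrow>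
        (\<exists>p\<ge>k. p \<notin> B' \<and> f (a, y) p \<noteq> e' p)"
      using L(2,3) by blast
  qed
  then show ?thesis using fus by blast
qed

text \<open>Shifts of the first tree are handled by \<open>moved\<close> within its own fusion,
  those of the others by thinning each of them afterwards. The bound \<open>p\<close> depends only
  on the given \<open>B\<close>, so that fusion can decide enough digits for all of them in
  advance.\<close>

lemma normalized_avoiding:
  fixes B :: "nat \<Rightarrow> nat set" and e :: "nat \<Rightarrow> cantor"
  assumes B: "\<And>m. infinite (B m)"
    and moving: "\<And>a x n L. a \<in> cube A b \<Longrightarrow>
      \<exists>z\<in>D \<inter> (cyl a n \<times> cyl x n). \<exists>p\<ge>L. f z p \<noteq> fst z p"
  shows "\<exists>A' b' B' e'. infinite A' \<and> A' \<subseteq> A \<and> b' \<in> cube A b \<and>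
    (\<forall>m. infinite (B' m) \<and> B' m \<subseteq> B m \<and> e' m \<in> cube (B m) (e m)) \<and>
    normalized_on f (cube_tree A' b')
      (range (case_nat (cube_tree A' b') (\<lambda>m. cube_tree (B' m) (e' m))))"
proof -
  obtain p where p: "\<forall>L. \<forall>n\<le>L. 2 ^ L \<le> card (B n \<inter> {L..<p L})"
    using ex_card_interval_ge[of B, OF B] by blast
  define R where "R L a x n \<longleftrightarrow>
    (\<forall>k<Suc L. inside k a x n) \<and> (\<forall>i<p L. decided i a x n) \<and> moved L a x n" for L a x n
  have pR: "persistent (R L)" for L
    unfolding R_def
    by (intro persistent_conj persistent_all_less persistent_inside persistent_decided
        persistent_moved)
  have dR: "dense_on (cube A b) (R L)" for L
    unfolding R_def
    by (intro dense_on_conj dense_on_all_less persistent_all_less persistent_inside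
        persistent_decided dense_inside dense_decided dense_moved moving)
  obtain A' b' where fus: "infinite A'" "A' \<subseteq> A" "b' \<in> cube A b"
    "\<forall>x n k. \<exists>L\<ge>k. \<exists>x'\<in>cyl x n. \<exists>n'\<ge>n. L \<le> n' \<and> A' \<inter> {L..<n'} = {} \<and>
       (\<forall>a\<in>cube A' b'. R L a x' n')"
    by (rule fusion[where R = R, OF infinite_A pR dR])
  have ins: "\<exists>x'\<in>cyl x n. \<exists>n'\<ge>n. \<forall>a\<in>cube A' b'. inside k a x' n'" for x n k
  proof -
    obtain L x' n' where L: "L \<ge> k" "x' \<in> cyl x n" "n' \<ge> n" "\<forall>a\<in>cube A' b'. R L a x' n'"
      using fus(4)[rule_format, where x = x and n = n and k = k] by blast
    then have "\<forall>a\<in>cube A' b'. inside k a x' n'" by (simp add: R_def)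
    then show ?thesis using L(2,3) by blast
  qed
  have dec: "\<exists>L\<ge>k. \<exists>x'\<in>cyl x n. \<exists>n'\<ge>n. L \<le> n' \<and> A' \<inter> {L..<n'} = {} \<and>
       (\<forall>a\<in>cube A' b'. \<forall>i<p L. decided i a x' n')" for x n k
    using fus(4)[rule_format, where x = x and n = n and k = k] unfolding R_def by blast
  have av0: "avoids (cube A' b') A' b'"
    unfolding avoids_def
  proof (intro allI)
    fix x n k
    obtain L x' n' where L: "L \<ge> k" "x' \<in> cyl x n" "n' \<ge> n" "A' \<inter> {L..<n'} = {}"
      "\<forall>a\<in>cube A' b'. moved L a x' n'"
      using fus(4)[rule_format, where x = x and n = n and k = k] unfolding R_def by blast
    have "\<exists>p\<ge>k. p \<notin> A' \<and> f (a, y) p \<noteq> b' p"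
      if a: "a \<in> cube A' b'" and y: "y \<in> cyl x' n'" and D: "(a, y) \<in> D" for a y
    proof -
      \<comment> \<open>\<open>q\<close> falls into the gap of \<open>A'\<close>, so
        \<open>a q\<close> equals \<open>b' q\<close>.\<close>
      obtain q where q: "q \<in> {L..<n'}" "f (a, y) q \<noteq> a q"
        using L(5) a y D unfolding moved_def by fastforce
      then have "q \<notin> A'" using L(4) by blast
      then show ?thesis using q a L(1) by (intro exI[of _ q]) (auto simp: cube_def)
    qed
    then show "\<exists>x'\<in>cyl x n. \<exists>n'\<ge>n. \<forall>a\<in>cube A' b'. \<forall>y\<in>cyl x' n'. (a, y) \<in> D \<longrightarrow>
        (\<exists>p\<ge>k. p \<notin> A' \<and> f (a, y) p \<noteq> b' p)"
      using L(2,3) by blast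
  qed
  have "\<exists>B' e'. infinite B' \<and> B' \<subseteq> B m \<and> e' \<in> cube (B m) (e m) \<and> avoids (cube A' b') B' e'" for m
    using ex_avoiding_subcube[OF B dec, of m m] p by blast
  then obtain B' e' where B': "\<And>m. infinite (B' m)" "\<And>m. B' m \<subseteq> B m"
    "\<And>m. e' m \<in> cube (B m) (e m)" "\<And>m. avoids (cube A' b') (B' m) (e' m)"
    by metis
  have "avoids (cube A' b') (case_nat A' B' m) (case_nat b' e' m)" for m
    using av0 B'(4) by (cases m) auto
  from normalized_avoids[OF fus(2,3) ins this]
  have "normalized_on f (cube_tree A' b')
      (range (\<lambda>m. cube_tree (case_nat A' B' m) (case_nat b' e' m)))" .
  moreover have "(\<lambda>m. cube_tree (case_nat A' B' m) (case_nat b' e' m)) =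
      case_nat (cube_tree A' b') (\<lambda>m. cube_tree (B' m) (e' m))"
    by (rule ext) (simp split: nat.split)
  ultimately have "normalized_on f (cube_tree A' b')
      (range (case_nat (cube_tree A' b') (\<lambda>m. cube_tree (B' m) (e' m))))" by (simp only:)
  then show ?thesis
    by (intro exI[of _ A'] exI[of _ b'] exI[of _ B'] exI[of _ e'] conjI allI fus(1-3) B'(1-3))
qed

end

section \<open>Combining the two cases\<close>

theorem theorem7p2:
  fixes T :: "nat \<Rightarrow> bool list set"
    and f :: "cantor \<times> baire \<Rightarrow> cantor"
  assumes "\<And>n. silver_tree (T n)"
    and "f \<in> borel_measurable borel"
  shows "\<exists>S :: nat \<Rightarrow> bool list set.
           (\<forall>n. silver_tree (S n) \<and> S n \<subseteq> T n) \<and> normalized_on f (S 0) (range S)"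
proof -
  have "\<exists>A b. infinite A \<and> T n = cube_tree A b" for n
    using silver_treeE[OF assms(1)[of n]] by blast
  then obtain A b where A: "\<And>n. infinite (A n)" and T: "\<And>n. T n = cube_tree (A n) (b n)"
    by metis
  \<comment> \<open>The branches of a Silver tree can form a nowhere dense set, so genericity is
    taken relative to their product with Baire space.\<close>
  let ?Y = "cube (A 0) (b 0) \<times> (UNIV :: baire set)"
  obtain G :: "nat \<Rightarrow> (cantor \<times> baire) set" where G: "\<forall>k. open (G k)"
    "\<forall>k U. open U \<longrightarrow> U \<inter> ?Y \<noteq> {} \<longrightarrow> U \<inter> ?Y \<inter> G k \<noteq> {}"
    "\<forall>i. \<exists>V W k. open V \<and> open W \<and> G k \<subseteq> V \<union> W \<and>
       (\<forall>z\<in>?Y \<inter> (\<Inter>k. G k). (z \<in> V \<longrightarrow> f z i) \<and> (z \<in> W \<longrightarrow> \<not> f z i))"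
    by (rule borel_relative_continuity[OF assms(2), where Y = ?Y])
  interpret generic_function "A 0" "b 0" f G
  proof
    show "U \<inter> ?Y \<inter> G k \<noteq> {}" if "open U" "U \<inter> ?Y \<noteq> {}" for U k
      using G(2)[rule_format, OF that] .
  qed (rule A G(1)[rule_format] G(3)[rule_format])+
  show ?thesis
  proof (cases "\<exists>a\<in>cube (A 0) (b 0). \<exists>x n L. \<forall>z\<in>D \<inter> (cyl a n \<times> cyl x n). \<forall>p\<ge>L. f z p = fst z p")
    case True
    then obtain a x n L where a: "a \<in> cube (A 0) (b 0)"
      and eq: "\<forall>z\<in>D \<inter> (cyl a n \<times> cyl x n). \<forall>p\<ge>L. f z p = fst z p" by blast
    obtain A' b' where A': "infinite A'" "A' \<subseteq> A 0" "b' \<in> cube (A 0) (b 0)"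
      "\<forall>U. normalized_on f (cube_tree A' b') U"
      using normalized_shift[OF a eq] by blast
    \<comment> \<open>The shift alternative does not mention the family of trees, so the other trees
      stay as they are.\<close>
    define S where "S = T(0 := cube_tree A' b')"
    have "silver_tree (S n) \<and> S n \<subseteq> T n" for n
      using A'(1-3) assms(1) T[of 0] silver_tree_cube_tree cube_tree_subset
      by (cases "n = 0") (simp_all add: S_def)
    then show ?thesis using A'(4) by (intro exI[of _ S]) (simp add: S_def)
  next
    case False
    then have moving: "\<exists>z\<in>D \<inter> (cyl a n \<times> cyl x n). \<exists>p\<ge>L. f z p \<noteq> fst z p"
      if "a \<in> cube (A 0) (b 0)" for a x n L
      using that by blast
    obtain A' b' B' e' where 1: "infinite A'" "A' \<subseteq> A 0" "b' \<in> cube (A 0) (b 0)"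
      "\<forall>m. infinite (B' m) \<and> B' m \<subseteq> A (Suc m) \<and> e' m \<in> cube (A (Suc m)) (b (Suc m))"
      "normalized_on f (cube_tree A' b')
         (range (case_nat (cube_tree A' b') (\<lambda>m. cube_tree (B' m) (e' m))))"
      using normalized_avoiding[where B = "\<lambda>m. A (Suc m)" and e = "\<lambda>m. b (Suc m)", OF A moving]
      by blast
    define S where "S = case_nat (cube_tree A' b') (\<lambda>m. cube_tree (B' m) (e' m))"
    have "silver_tree (S n) \<and> S n \<subseteq> T n" for n
      using 1(1-4) by (cases n) (simp_all add: S_def T silver_tree_cube_tree cube_tree_subset)
    then show ?thesis using 1(5) by (intro exI[of _ S]) (simp add: S_def)
  qed
qed

end
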